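(* Let $H=(\sigma,\alpha)$ be a collection of hypermaps on the set $\{1,2,\ldots,n\}$ and assume that $(1,2,\ldots,m)$ is a cycle of $\alpha$ of length $m\ge 2$. Then the Whitney polynomial of $H$ is given by $$R(H;u,v)=\sum_{k=1}^m R(\psi_k(H);u,v)\cdot w_k,$$ where $$w_k=\begin{cases} u^{\kappa(\phi_k(H))-\kappa(H)}\,v & \text{if } k\neq 1 \text{ and } 1 \text{ and } k \text{ belong to the same cycle of } \sigma;\\ u^{\kappa(\phi_k(H))-\kappa(H)} & \text{otherwise,}\end{cases}$$ and each $\psi_k(H)$ is the collection of hypermaps $$\psi_k(H)=\begin{cases} ((1,k)\sigma,\ (1,k)\alpha(1,k-1)) & \text{if } z((1,k)\sigma)\le z(\sigma) \text{ and } \kappa(\phi_k(H))=\kappa(H),\\ ((1,2)(1,k)\sigma,\ (1,2)(1,k)\alpha) & \text{if } z((1,k)\sigma)\le z(\sigma) \text{ and } \kappa(\phi_k(H))=\kappa(H)+1,\\ (\sigma,\ \alpha(1,k-1)(1,m)) & \text{if } z((1,k)\sigma)=z(\sigma)+1 \text{ and } \kappa(\phi_k(H))=\kappa(H),\\ ((1,2)\sigma,\ (1,2)\alpha(k-1,m)) & \text{if } z((1,k)\sigma)=z(\sigma)+1 \text{ and } \kappa(\phi_k(H))=\kappa(H)+1. \end{cases}$$ Here one counts modulo $m$ ($k-1$ is read as $m$ when $k=1$), and $(1,1)$ denotes the identity permutation.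
   Context: Permutations act on a finite set and are composed from right to left: $(\pi\rho)(i)=\pi(\rho(i))$. The symbol $(i,j)$ denotes a transposition, and $z(\pi)$ is the number of cycles of $\pi$ (fixed points included). A collection of hypermaps $(\sigma,\alpha)$ on a finite set of points is an ordered pair of permutations of that set. Its connected components are the orbits of the permutation group generated by $\sigma$ and $\alpha$; their number is $\kappa(\sigma,\alpha)$. A permutation $\beta$ is a refinement of $\alpha$ (written $\beta\le\alpha$) if $\beta$ is obtained by replacing each cycle $\alpha_i$ of $\alpha$ by a permutation $\beta_i$ acting on the same set of $n_i$ points in such a way that the genus $g(\alpha_i,\beta_i)$ is $0$, that is, $z(\beta_i)+z(\beta_i^{-1}\alpha_i)=n_i+1$ (equivalently, the cycles of $\beta_i$ form a noncrossing partition in the circular order of $\alpha_i$, each listed in that circular order). The Whitney polynomial of a collection of hypermaps $(\sigma,\alpha)$ on $n$ points is $$R(\sigma,\alpha;u,v)=\sum_{\beta\leq\alpha}u^{\kappa(\sigma,\beta)-\kappa(\sigma,\alpha)}\,v^{\kappa(\sigma,\beta)+n-z(\beta)-z(\sigma)}.$$ For $H=(\sigma,\alpha)$ with a cycle $(1,2,\ldots,m)$ of $\alpha$, $m\ge2$, and $k\in\{1,\ldots,m\}$, the collection of hypermaps $\phi_k(H)=(\sigma_k,\alpha_k)$ is defined by: $\sigma_k=\sigma$ if $1$ and $k$ belong to the same cycle of $\sigma$, and $\sigma_k=(1,k)\sigma$ otherwise; $\alpha_k$ is obtained from $\alpha$ by replacing the cycle $(1,2,\ldots,m)$ with $(1)(2,\ldots,m)$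 if $k\in\{1,2\}$, and with $(1)(2,\ldots,k-1)(k,\ldots,m)$ if $k\notin\{1,2\}$. *)

theory Defs
  imports
    "HOL-Combinatorics.Orbits"
    "HOL-Algebra.Group_Action"
    "HOL-Algebra.Sym_Groups"
begin

text \<open>
  A permutation of a finite set \<open>S\<close> is a function \<open>p\<close> with \<open>p permutes S\<close>, and a collection of
  hypermaps on \<open>{1..n}\<close> is a pair of functions that permute \<open>{1..n}\<close>. Composition of permutations
  is \<open>\<circ>\<close> (right to left).
\<close>

type_synonym hypermaps = "(nat \<Rightarrow> nat) \<times> (nat \<Rightarrow> nat)"

definition hypermaps_on :: "nat \<Rightarrow> hypermaps \<Rightarrow> bool" where
  "hypermaps_on n H \<longleftrightarrow> fst H permutes {1..n} \<and> snd H permutes {1..n}"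

abbreviation transp :: "nat \<Rightarrow> nat \<Rightarrow> nat \<Rightarrow> nat" where
  "transp i j \<equiv> Transposition.transpose i j"

text \<open>The underlying point sets of the cycles of \<open>p\<close> on \<open>S\<close>, fixed points included.\<close>

definition cycle_sets :: "'a set \<Rightarrow> ('a \<Rightarrow> 'a) \<Rightarrow> 'a set set" where
  "cycle_sets S p = Orbits.orbit p ` S"

definition num_cycles :: "'a set \<Rightarrow> ('a \<Rightarrow> 'a) \<Rightarrow> nat" where
  "num_cycles S p = card (cycle_sets S p)"

definition same_cycle :: "('a \<Rightarrow> 'a) \<Rightarrow> 'a \<Rightarrow> 'a \<Rightarrow> bool" where
  "same_cycle p i j \<longleftrightarrow> j \<in> Orbits.orbit p i"

definition list_is_cycle :: "('a \<Rightarrow> 'a) \<Rightarrow> 'a list \<Rightarrow> bool" where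
  "list_is_cycle p cs \<longleftrightarrow> distinct cs \<and> (\<forall>i \<in> set cs. p i = cycle_of_list cs i)"

definition perm_group :: "nat \<Rightarrow> hypermaps \<Rightarrow> (nat \<Rightarrow> nat) monoid" where
  "perm_group n H = (sym_group n)\<lparr>carrier := generate (sym_group n) {fst H, snd H}\<rparr>"

definition num_components :: "nat \<Rightarrow> hypermaps \<Rightarrow> nat" where
  "num_components n H = card (Group_Action.orbits (perm_group n H) {1..n} id)"

text \<open>
  Here \<open>C\<close> ranges over the cycles of \<open>\<alpha>\<close>, and \<open>perm_restrict \<alpha> C\<close>, \<open>perm_restrict \<beta> C\<close> are the
  permutations \<open>\<alpha>\<^sub>i\<close>, \<open>\<beta>\<^sub>i\<close> of \<open>C\<close>; the equation says that the genus of this pair is zero.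
\<close>

definition refinement :: "'a set \<Rightarrow> ('a \<Rightarrow> 'a) \<Rightarrow> ('a \<Rightarrow> 'a) \<Rightarrow> bool" where
  "refinement S \<beta> \<alpha> \<longleftrightarrow> \<beta> permutes S \<and>
     (\<forall>C \<in> cycle_sets S \<alpha>.
        perm_restrict \<beta> C permutes C \<and>
        num_cycles C (perm_restrict \<beta> C)
          + num_cycles C (Hilbert_Choice.inv (perm_restrict \<beta> C) \<circ> perm_restrict \<alpha> C)
        = card C + 1)"

text \<open>
  The subtractions on natural numbers do not truncate. A refinement \<open>\<beta>\<close> of \<open>\<alpha>\<close> has
  \<open>\<kappa>(\<sigma>,\<beta>) \<ge> \<kappa>(\<sigma>,\<alpha>)\<close>. The bipartite graph with the cycles of \<open>\<beta>\<close> and \<open>\<sigma>\<close> as vertices and the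
  \<open>n\<close> points as edges has \<open>\<kappa>(\<sigma>,\<beta>)\<close> components, whence \<open>z(\<beta>) + z(\<sigma>) \<le> \<kappa>(\<sigma>,\<beta>) + n\<close>.

  The polynomial is evaluated at elements \<open>u\<close>, \<open>v\<close> of an arbitrary commutative ring; taking the
  two indeterminates of an integer polynomial ring gives the formal polynomial.
\<close>

definition whitney :: "nat \<Rightarrow> hypermaps \<Rightarrow> 'r::comm_ring_1 \<Rightarrow> 'r \<Rightarrow> 'r" where
  "whitney n = (\<lambda>(\<sigma>, \<alpha>) u v.
     \<Sum>\<beta> | refinement {1..n} \<beta> \<alpha>.
       u ^ (num_components n (\<sigma>, \<beta>) - num_components n (\<sigma>, \<alpha>)) *
       v ^ (num_components n (\<sigma>, \<beta>) + n - num_cycles {1..n} \<beta> - num_cycles {1..n} \<sigma>))"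

text \<open>
  The following maps are meant for collections of hypermaps \<open>(\<sigma>, \<alpha>)\<close> for which \<open>(1, 2, \<dots>, m)\<close>
  is a cycle of \<open>\<alpha>\<close>, with \<open>2 \<le> m\<close> and \<open>1 \<le> k \<le> m\<close>.
\<close>

definition phi :: "nat \<Rightarrow> nat \<Rightarrow> hypermaps \<Rightarrow> hypermaps" where
  "phi m k = (\<lambda>(\<sigma>, \<alpha>).
     (if same_cycle \<sigma> 1 k then \<sigma> else transp 1 k \<circ> \<sigma>,
      \<lambda>i. if i \<notin> {1..m} then \<alpha> i
          else if k \<in> {1, 2} then cycle_of_list [2..<m + 1] i
          else (cycle_of_list [2..<k] \<circ> cycle_of_list [k..<m + 1]) i))"

definition cyc_pred :: "nat \<Rightarrow> nat \<Rightarrow> nat" where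
  "cyc_pred m k = (if k = 1 then m else k - 1)"

text \<open>
  The four cases exhaust all possibilities, since multiplying by a transposition raises \<open>z\<close> by at
  most one and \<open>\<kappa>(\<phi>\<^sub>k(H)) - \<kappa>(H)\<close> is zero or one; the value \<open>undefined\<close> is never taken.
\<close>

definition psi :: "nat \<Rightarrow> nat \<Rightarrow> nat \<Rightarrow> hypermaps \<Rightarrow> hypermaps" where
  "psi n m k H = (case H of (\<sigma>, \<alpha>) \<Rightarrow>
     let z = num_cycles {1..n}; \<kappa> = num_components n; l = cyc_pred m k in
     if z (transp 1 k \<circ> \<sigma>) \<le> z \<sigma> \<and> \<kappa> (phi m k H) = \<kappa> H then
       (transp 1 k \<circ> \<sigma>, transp 1 k \<circ> \<alpha> \<circ> transp 1 l)
     else if z (transp 1 k \<circ> \<sigma>) \<le> z \<sigma> \<and> \<kappa> (phi m k H) = \<kappa> H + 1 then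
       (transp 1 2 \<circ> transp 1 k \<circ> \<sigma>, transp 1 2 \<circ> transp 1 k \<circ> \<alpha>)
     else if z (transp 1 k \<circ> \<sigma>) = z \<sigma> + 1 \<and> \<kappa> (phi m k H) = \<kappa> H then
       (\<sigma>, \<alpha> \<circ> transp 1 l \<circ> transp 1 m)
     else if z (transp 1 k \<circ> \<sigma>) = z \<sigma> + 1 \<and> \<kappa> (phi m k H) = \<kappa> H + 1 then
       (transp 1 2 \<circ> \<sigma>, transp 1 2 \<circ> \<alpha> \<circ> transp l m)
     else undefined)"

text \<open>The exponent of \<open>u\<close> does not truncate: the components of \<open>phi m k H\<close> refine those of \<open>H\<close>.\<close>

definition weight :: "nat \<Rightarrow> nat \<Rightarrow> nat \<Rightarrow> hypermaps \<Rightarrow> 'r::comm_ring_1 \<Rightarrow> 'r \<Rightarrow> 'r" where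
  "weight n m k H u v =
     (if k \<noteq> 1 \<and> same_cycle (fst H) 1 k
      then u ^ (num_components n (phi m k H) - num_components n H) * v
      else u ^ (num_components n (phi m k H) - num_components n H))"

end

theory Submission
  imports Defs
begin

text \<open>
  Sort the refinements \<open>\<beta>\<close> of \<open>\<alpha>\<close> by \<open>k = \<beta> 1\<close>. The map \<open>\<beta> \<mapsto> (1,k)\<beta>\<close> is a bijection from the
  refinements with \<open>\<beta> 1 = k\<close> onto the refinements of \<open>\<alpha>\<^sub>k\<close>, and it turns the components of
  \<open>(\<sigma>,\<beta>)\<close> into those of \<open>(\<sigma>\<^sub>k,(1,k)\<beta>)\<close>; comparing numbers of cycles gives the sum over the
  \<open>\<phi>\<^sub>k(H)\<close> with weights \<open>w\<^sub>k\<close>. Either \<open>\<psi>\<^sub>k(H) = \<phi>\<^sub>k(H)\<close>, or \<open>1\<close> and \<open>2\<close> lie in different components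
  of \<open>\<phi>\<^sub>k(H)\<close> and \<open>\<psi>\<^sub>k(H)\<close> arises by joining these through \<open>(1,2)\<close>, which does not change \<open>R\<close>.

  The bijection rests on a global description of refinements: with \<open>\<ell>(\<pi>) = n - z(\<pi>)\<close>, the least
  number of transpositions whose product is \<open>\<pi>\<close>, one has
  \<open>\<ell>(\<alpha>) \<le> \<ell>(\<beta>) + \<ell>(\<beta>\<^sup>-\<^sup>1\<alpha>)\<close>, and the refinements are the cases of equality.
\<close>

section \<open>Equivalence closures and permutations\<close>

abbreviation tp :: "'a \<Rightarrow> 'a \<Rightarrow> 'a \<Rightarrow> 'a" where
  "tp \<equiv> Transposition.transpose"

text \<open>Cycles of \<open>p\<close> and components of \<open>(\<sigma>, \<beta>)\<close> are the
  classes of \<open>conn R\<close> for \<open>R = gr p\<close> and \<open>R = gr \<sigma> \<union> gr \<beta>\<close>.\<close>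

definition conn :: "('a \<times> 'a) set \<Rightarrow> ('a \<times> 'a) set" where
  "conn R = (R \<union> R\<inverse>)\<^sup>*"

definition gr :: "('a \<Rightarrow> 'a) \<Rightarrow> ('a \<times> 'a) set" where
  "gr p = range (\<lambda>x. (x, p x))"

definition num_classes :: "'a set \<Rightarrow> ('a \<times> 'a) set \<Rightarrow> nat" where
  "num_classes S R = card ((\<lambda>x. conn R `` {x}) ` S)"

section \<open>Equivalence closures and how an added pair changes the number of classes\<close>

lemma conn_refl [simp]: "(x, x) \<in> conn R"
  by (simp add: conn_def)

lemma conn_sym: "(x, y) \<in> conn R \<Longrightarrow> (y, x) \<in> conn R"
  unfolding conn_def by (meson symD sym_Un_converse sym_rtrancl)

lemma conn_trans: "(x, y) \<in> conn R \<Longrightarrow> (y, z) \<in> conn R \<Longrightarrow> (x, z) \<in> conn R"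
  unfolding conn_def by (rule rtrancl_trans)

lemma conn_incl: "r \<in> R \<Longrightarrow> r \<in> conn R"
  unfolding conn_def by (cases r) blast

lemma conn_induct [consumes 1, case_names refl step step_conv]:
  assumes "(x, y) \<in> conn R"
    and "P x"
    and "\<And>y z. (x, y) \<in> conn R \<Longrightarrow> P y \<Longrightarrow> (y, z) \<in> R \<Longrightarrow> P z"
    and "\<And>y z. (x, y) \<in> conn R \<Longrightarrow> P y \<Longrightarrow> (z, y) \<in> R \<Longrightarrow> P z"
  shows "P y"
  using assms(1) unfolding conn_def
proof (induction rule: rtrancl_induct)
  case base
  show ?case by (rule assms(2))
next
  case (step y z)
  then show ?case using assms(3,4) unfolding conn_def by blast
qed

lemma conn_subsetI:
  assumes "R \<subseteq> conn Q"
  shows "conn R \<subseteq> conn Q"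
proof (clarify)
  fix x y assume "(x, y) \<in> conn R"
  then show "(x, y) \<in> conn Q"
  proof (induction rule: conn_induct)
    case (step y z)
    then show ?case using assms conn_trans[of x y Q z] by blast
  next
    case (step_conv y z)
    then show ?case using assms conn_trans[of x y Q z] conn_sym[of z y Q] by blast
  qed simp
qed

lemma conn_mono: "R \<subseteq> Q \<Longrightarrow> conn R \<subseteq> conn Q"
  by (intro conn_subsetI) (auto intro: conn_incl)

lemma conn_eqI: "R \<subseteq> conn Q \<Longrightarrow> Q \<subseteq> conn R \<Longrightarrow> conn R = conn Q"
  by (simp add: conn_subsetI subset_antisym)

lemma conn_insert_absorb: "(a, b) \<in> conn R \<Longrightarrow> conn (insert (a, b) R) = conn R"
  by (intro conn_eqI) (auto intro: conn_incl)

lemma conn_Un_cong: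
  assumes "conn R = conn R'" "conn Q = conn Q'"
  shows "conn (R \<union> Q) = conn (R' \<union> Q')"
proof (intro conn_eqI Un_least)
  have i: "A \<subseteq> conn A" for A :: "('a \<times> 'a) set" by (auto intro: conn_incl)
  have u: "conn A \<subseteq> conn (A \<union> B)" "conn B \<subseteq> conn (A \<union> B)" for A B :: "('a \<times> 'a) set"
    by (rule conn_mono; blast)+
  show "R \<subseteq> conn (R' \<union> Q')" "Q \<subseteq> conn (R' \<union> Q')" "R' \<subseteq> conn (R \<union> Q)" "Q' \<subseteq> conn (R \<union> Q)"
    using i[of R] i[of Q] i[of R'] i[of Q'] u[of R Q] u[of R' Q'] u[of Q R] u[of Q' R'] assms
    by blast+
qed

text \<open>Crossing the new edge back undoes the first crossing, so a walk never needs that edge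
  more than once.\<close>

lemma conn_insert_iff:
  "(x, y) \<in> conn (insert (a, b) R) \<longleftrightarrow>
     (x, y) \<in> conn R \<or> (x, a) \<in> conn R \<and> (b, y) \<in> conn R \<or> (x, b) \<in> conn R \<and> (a, y) \<in> conn R"
  (is "?l \<longleftrightarrow> ?r y")
proof
  assume ?l
  then show "?r y"
  proof (induction rule: conn_induct)
    case (step y z)
    then consider "y = a" "z = b" | "(y, z) \<in> conn R" by (auto intro: conn_incl)
    then show ?case
    proof cases
      case 1
      then show ?thesis using step.IH by auto
    next
      case 2
      then show ?thesis using step.IH conn_trans[of _ y R z] by blast
    qed
  next
    case (step_conv y z)
    then consider "y = b" "z = a" | "(y, z) \<in> conn R" by (auto intro: conn_incl conn_sym)
    then show ?case
    proof cases
      case 1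
      then show ?thesis using step_conv.IH by auto
    next
      case 2
      then show ?thesis using step_conv.IH conn_trans[of _ y R z] by blast
    qed
  qed simp
next
  have "conn R \<subseteq> conn (insert (a, b) R)" by (intro conn_mono) auto
  moreover have "(a, b) \<in> conn (insert (a, b) R)" by (simp add: conn_incl)
  ultimately show "?r y \<Longrightarrow> ?l" by (meson conn_sym conn_trans subsetD)
qed

lemma conn_Image_eq_iff: "conn R `` {x} = conn R `` {y} \<longleftrightarrow> (x, y) \<in> conn R"
  unfolding set_eq_iff Image_singleton_iff by (meson conn_refl conn_sym conn_trans)

text \<open>The classes of \<open>a\<close> and \<open>b\<close> fuse into their union, which was
  not a class before, and all other classes stay as they were.\<close>

lemma num_classes_insert:
  assumes "finite S" "a \<in> S" "b \<in> S" "(a, b) \<notin> conn R"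
  shows "num_classes S R = Suc (num_classes S (insert (a, b) R))"
proof -
  define c where "c = (\<lambda>x. conn R `` {x})"
  define c' where "c' = (\<lambda>x. conn (insert (a, b) R) `` {x})"
  have ceq: "c x = c y \<longleftrightarrow> (x, y) \<in> conn R" for x y
    unfolding c_def by (rule conn_Image_eq_iff)
  have merged: "c' x = c a \<union> c b" if "(x, a) \<in> conn R \<or> (x, b) \<in> conn R" for x
    using that unfolding c_def c'_def set_eq_iff Un_iff Image_singleton_iff conn_insert_iff
    by (meson conn_sym conn_trans)
  have other: "c' x = c x" if "(x, a) \<notin> conn R" "(x, b) \<notin> conn R" for x
    using that unfolding c_def c'_def by (auto simp: conn_insert_iff)
  have "c' ` S = insert (c a \<union> c b) (c ` S - {c a, c b})"
  proof (intro equalityI subsetI)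
    fix X assume "X \<in> c' ` S"
    then obtain x where x: "x \<in> S" "X = c' x" by blast
    show "X \<in> insert (c a \<union> c b) (c ` S - {c a, c b})"
      using x merged[of x] other[of x] ceq by (cases "(x, a) \<in> conn R \<or> (x, b) \<in> conn R") auto
  next
    fix X assume X: "X \<in> insert (c a \<union> c b) (c ` S - {c a, c b})"
    show "X \<in> c' ` S"
    proof (cases "X = c a \<union> c b")
      case True
      then show ?thesis using merged[of a] assms(2) by auto
    next
      case False
      then obtain x where "x \<in> S" "X = c x" "c x \<noteq> c a" "c x \<noteq> c b" using X by blast
      then show ?thesis using other[of x] ceq by (metis imageI)
    qed
  qed
  moreover have "c a \<union> c b \<notin> c ` S"
  proof
    assume "c a \<union> c b \<in> c ` S"
    then obtain x where "c a \<union> c b = c x" by blast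
    moreover have "a \<in> c a" "b \<in> c b" by (simp_all add: c_def)
    ultimately have "a \<in> c x" "b \<in> c x" by blast+
    then have "(x, a) \<in> conn R" "(x, b) \<in> conn R" by (simp_all add: c_def)
    then show False using assms(4) by (meson conn_sym conn_trans)
  qed
  moreover have "card (c ` S - {c a, c b}) + 2 = card (c ` S)"
  proof -
    have "{c a, c b} \<subseteq> c ` S" "card {c a, c b} = 2" using assms ceq by auto
    then show ?thesis using assms(1)
      by (metis card_Diff_subset card_mono finite_imageI finite.emptyI finite_insert le_add_diff_inverse2)
  qed
  ultimately have "card (c ` S) = Suc (card (c' ` S))" using assms(1) by simp
  then show ?thesis by (simp add: num_classes_def c_def c'_def)
qed

lemma num_classes_conn_cong: "conn R = conn Q \<Longrightarrow> num_classes S R = num_classes S Q"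
  by (simp add: num_classes_def)

lemma num_classes_le_insert:
  assumes "finite S" "a \<in> S" "b \<in> S"
  shows "num_classes S R \<le> Suc (num_classes S (insert (a, b) R))"
    and "num_classes S (insert (a, b) R) \<le> num_classes S R"
proof -
  have "num_classes S R = Suc (num_classes S (insert (a, b) R)) \<or>
      num_classes S (insert (a, b) R) = num_classes S R"
    using num_classes_insert[OF assms, of R] num_classes_conn_cong[OF conn_insert_absorb, of a b R S]
    by blast
  then show "num_classes S R \<le> Suc (num_classes S (insert (a, b) R))"
    and "num_classes S (insert (a, b) R) \<le> num_classes S R" by linarith+
qed

lemma num_classes_antimono:
  assumes "finite S" "conn R \<subseteq> conn Q"
  shows "num_classes S Q \<le> num_classes S R"
proof -
  \<comment> \<open>Saturating under \<open>Q\<close> sends each class of \<open>R\<close> to the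
    class of \<open>Q\<close> around it, so the fine classes map onto the coarse ones.\<close>
  have *: "(\<Union>y\<in>conn R `` {x}. conn Q `` {y}) = conn Q `` {x}" for x
  proof (intro equalityI subsetI)
    fix z assume "z \<in> (\<Union>y\<in>conn R `` {x}. conn Q `` {y})"
    then obtain y where "(x, y) \<in> conn R" "(y, z) \<in> conn Q" by blast
    then show "z \<in> conn Q `` {x}" using assms(2) conn_trans[of x y Q z] by blast
  qed (use conn_refl[of x R] in blast)
  have "(\<lambda>X. \<Union>x\<in>X. conn Q `` {x}) ` (\<lambda>x. conn R `` {x}) ` S = (\<lambda>x. conn Q `` {x}) ` S"
    unfolding image_image * ..
  then show ?thesis unfolding num_classes_def using assms(1) by (metis card_image_le finite_imageI)
qed

section \<open>Cycles of a permutation as classes of its graph\<close>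

lemma gr_conn [simp]: "(x, p x) \<in> conn (gr p)"
  by (auto simp: gr_def intro: conn_incl)

lemma gr_subset_conn_iff: "gr p \<subseteq> conn R \<longleftrightarrow> (\<forall>x. (x, p x) \<in> conn R)"
  by (auto simp: gr_def)

lemma permutes_finite_permutation: "p permutes S \<Longrightarrow> finite S \<Longrightarrow> permutation p"
  by (auto simp: permutation_permutes)

text \<open>A forward orbit makes no backward steps; for a \<open>permutation\<close> each point
  lies in its own orbit, so a backward step can be replaced by going round the cycle.\<close>

lemma orbit_eq_conn:
  assumes "permutation p"
  shows "Orbits.orbit p x = conn (gr p) `` {x}"
proof (intro equalityI subsetI)
  fix y assume "y \<in> Orbits.orbit p x"
  then show "y \<in> conn (gr p) `` {x}"
    by induction (auto intro: conn_trans[OF _ gr_conn])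
next
  fix y assume "y \<in> conn (gr p) `` {x}"
  then have "(x, y) \<in> conn (gr p)" by simp
  then show "y \<in> Orbits.orbit p x"
  proof (induction rule: conn_induct)
    case refl
    show ?case by (rule permutation_self_in_orbit[OF assms])
  next
    case (step y z)
    then show ?case by (auto simp: gr_def intro: orbit.intros)
  next
    case (step_conv y z)
    then have "y = p z" by (auto simp: gr_def)
    then have "y \<in> Orbits.orbit p x" "Orbits.orbit p y = Orbits.orbit p z"
      using step_conv.IH permutation_orbit_step[OF assms, of z] by simp_all
    then have "x \<in> Orbits.orbit p z"
      using orbit_swap[OF permutation_self_in_orbit[OF assms]] by blast
    then show ?case by (rule orbit_swap[OF permutation_self_in_orbit[OF assms]])
  qed
qed

lemma mem_orbit_iff_conn: "permutation p \<Longrightarrow> y \<in> Orbits.orbit p x \<longleftrightarrow> (x, y) \<in> conn (gr p)"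
  by (simp add: orbit_eq_conn)

lemma num_cycles_eq_num_classes: "permutation p \<Longrightarrow> num_cycles S p = num_classes S (gr p)"
  by (simp add: num_cycles_def cycle_sets_def num_classes_def orbit_eq_conn)

lemma conn_gr_inv:
  assumes "permutation p"
  shows "conn (gr (inv' p)) = conn (gr p)"
proof -
  have p: "bij p" using assms by (rule permutation_bijective)
  have "(x, inv' p x) \<in> conn (gr p)" for x
    using conn_sym[OF gr_conn[where x = "inv' p x" and p = p]] p by (simp add: bij_is_surj surj_f_inv_f)
  moreover have "(x, p x) \<in> conn (gr (inv' p))" for x
    using conn_sym[OF gr_conn[where x = "p x" and p = "inv' p"]] p by (simp add: bij_is_inj)
  ultimately show ?thesis
    by (intro conn_eqI) (simp_all add: gr_subset_conn_iff)
qed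

text \<open>\<open>tp a b\<close> moves points only along the edge \<open>(a, b)\<close>, so in the
  presence of that edge \<open>p x\<close> and \<open>tp a b (p x)\<close> are interchangeable. The
  extra \<open>R\<close> allows the graph of a second permutation to ride along.\<close>

lemma conn_insert_transp:
  "conn (insert (a, b) (gr (tp a b \<circ> p) \<union> R)) = conn (insert (a, b) (gr p \<union> R))"
proof -
  have t: "(x, tp a b x) \<in> conn (insert (a, b) Q)" for x and Q :: "('a \<times> 'a) set"
    by (auto simp: Transposition.transpose_def conn_incl intro: conn_sym)
  have q: "(x, q x) \<in> conn (insert (a, b) (gr q \<union> R))" for x and q :: "'a \<Rightarrow> 'a"
    by (intro conn_incl) (auto simp: gr_def)
  have "(x, (tp a b \<circ> p) x) \<in> conn (insert (a, b) (gr p \<union> R))" for x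
    using conn_trans[OF q[of x p] t] by simp
  moreover have "(x, p x) \<in> conn (insert (a, b) (gr (tp a b \<circ> p) \<union> R))" for x
    using conn_trans[OF q[of x "tp a b \<circ> p"] t] by simp
  ultimately have "gr (tp a b \<circ> p) \<subseteq> conn (insert (a, b) (gr p \<union> R))"
    "gr p \<subseteq> conn (insert (a, b) (gr (tp a b \<circ> p) \<union> R))"
    by (simp_all only: gr_subset_conn_iff simp_thms)
  then show ?thesis
    by (intro conn_eqI) (auto simp: conn_incl)
qed

section \<open>The effect of a transposition on cycles and their number\<close>

lemma funpow_agree:
  fixes p q :: "'a \<Rightarrow> 'a"
  assumes "\<And>y. p y \<notin> T \<Longrightarrow> q y = p y"
    and "\<And>i. 0 < i \<Longrightarrow> i < n \<Longrightarrow> (p ^^ i) x \<notin> T"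
  shows "i < n \<Longrightarrow> (q ^^ i) x = (p ^^ i) x"
proof (induction i)
  case (Suc i)
  then show ?case using assms(2)[of "Suc i"] assms(1)[of "(p ^^ i) x"] by simp
qed simp

text \<open>\<open>tp a b \<circ> p\<close> differs from \<open>p\<close> only where
  \<open>p\<close> takes the value \<open>a\<close> or \<open>b\<close>; until the iterates meet one
  of these, both maps follow the same path.\<close>

lemma funpow_transp_comp:
  fixes p :: "'a \<Rightarrow> 'a"
  assumes "\<And>i. 0 < i \<Longrightarrow> i < n \<Longrightarrow> (p ^^ i) x \<notin> {a, b}" "0 < n"
  shows "((tp a b \<circ> p) ^^ n) x = tp a b ((p ^^ n) x)"
    and "i < n \<Longrightarrow> ((tp a b \<circ> p) ^^ i) x = (p ^^ i) x"
proof -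
  have *: "((tp a b \<circ> p) ^^ i) x = (p ^^ i) x" if "i < n" for i
    by (rule funpow_agree[where T = "{a, b}" and n = n, OF _ assms(1) that]) auto
  obtain k where "n = Suc k" using assms(2) gr0_implies_Suc by blast
  then show "((tp a b \<circ> p) ^^ n) x = tp a b ((p ^^ n) x)"
    using *[of k] by (simp only: funpow.simps comp_apply lessI simp_thms)
  show "i < n \<Longrightarrow> ((tp a b \<circ> p) ^^ i) x = (p ^^ i) x" by (rule *)
qed

text \<open>The cycle of \<open>a\<close> avoids \<open>b\<close>, so the first exceptional step is
  the one that closes it; there the new permutation lands on \<open>b\<close> instead of
  \<open>a\<close>.\<close>

lemma transp_comp_joins:
  assumes "permutation p" "b \<notin> Orbits.orbit p a"
  shows "b \<in> Orbits.orbit (tp a b \<circ> p) a"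
proof -
  define n where "n = funpow_dist1 p a a"
  have "a \<in> Orbits.orbit p a" using assms(1) by (rule permutation_self_in_orbit)
  then have n: "(p ^^ n) a = a" unfolding n_def by (rule funpow_dist1_prop)
  have "0 < n" by (simp add: n_def)
  have "(p ^^ i) a \<notin> {a, b}" if "0 < i" "i < n" for i
  proof -
    have "(p ^^ i) a \<noteq> a" using that unfolding n_def by (rule funpow_dist1_least)
    moreover have "(p ^^ i) a \<in> Orbits.orbit p a" using that(1) unfolding orbit_altdef by blast
    ultimately show ?thesis using assms(2) by auto
  qed
  from funpow_transp_comp(1)[OF this \<open>0 < n\<close>] have "((tp a b \<circ> p) ^^ n) a = b"
    unfolding n by simp
  then show ?thesis using \<open>0 < n\<close> unfolding orbit_altdef mem_Collect_eq
    by (intro exI[of _ n] conjI) (rule sym)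
qed

text \<open>At the step where \<open>p\<close> first reaches \<open>b\<close> from \<open>a\<close>,
  the new permutation returns to \<open>a\<close>. Its cycle closes there, and no earlier point is
  \<open>b\<close>.\<close>

lemma transp_comp_separates:
  assumes "a \<noteq> b" "b \<in> Orbits.orbit p a"
  shows "b \<notin> Orbits.orbit (tp a b \<circ> p) a"
proof -
  define n where "n = funpow_dist1 p a b"
  have n: "(p ^^ n) a = b" unfolding n_def using assms(2) by (rule funpow_dist1_prop)
  have "0 < n" by (simp add: n_def)
  have *: "(p ^^ i) a \<notin> {a, b}" if "0 < i" "i < n" for i
  proof -
    have "(p ^^ i) a \<noteq> b" using that unfolding n_def by (rule funpow_dist1_least)
    moreover have "(p ^^ i) a \<noteq> (p ^^ 0) a"
      using that unfolding n_def by (intro funpow_neq_less_funpow_dist1[OF assms(2)]) simp_all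
    ultimately show ?thesis by simp
  qed
  from funpow_transp_comp(1)[OF * \<open>0 < n\<close>] have "((tp a b \<circ> p) ^^ n) a = a"
    unfolding n by simp
  then have "Orbits.orbit (tp a b \<circ> p) a = {((tp a b \<circ> p) ^^ i) a |i. i < n}"
    using \<open>0 < n\<close> by (rule orbit_altdef_bounded)
  moreover have "((tp a b \<circ> p) ^^ i) a \<noteq> b" if "i < n" for i
  proof (cases "i = 0")
    case False
    then have "(p ^^ i) a \<notin> {a, b}" using that by (intro *) simp_all
    moreover have eq: "((tp a b \<circ> p) ^^ i) a = (p ^^ i) a"
      using * \<open>0 < n\<close> that by (rule funpow_transp_comp(2))
    ultimately show ?thesis unfolding eq by blast
  qed (simp add: assms(1))
  ultimately show ?thesis by (simp only: mem_Collect_eq) metis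
qed

lemma conn_gr_transp_comp:
  assumes "permutation p" "b \<notin> Orbits.orbit p a"
  shows "conn (gr (tp a b \<circ> p)) = conn (insert (a, b) (gr p))"
proof -
  have "permutation (tp a b \<circ> p)"
    using assms(1) by (intro permutation_compose permutation_swap_id)
  then have "(a, b) \<in> conn (gr (tp a b \<circ> p))"
    using transp_comp_joins[OF assms] by (simp add: mem_orbit_iff_conn)
  from conn_insert_absorb[OF this] show ?thesis
    using conn_insert_transp[of a b p "{}"] by simp
qed

lemma transp_comp_permutes:
  "p permutes S \<Longrightarrow> a \<in> S \<Longrightarrow> b \<in> S \<Longrightarrow> tp a b \<circ> p permutes S"
  by (rule permutes_compose[OF _ permutes_swap_id])

lemma comp_transp_permutes:
  "p permutes S \<Longrightarrow> a \<in> S \<Longrightarrow> b \<in> S \<Longrightarrow> p \<circ> tp a b permutes S"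
  by (rule permutes_compose[OF permutes_swap_id])

lemma num_cycles_transp_comp_diff:
  assumes fin: "finite S" and p: "p permutes S" and ab: "a \<in> S" "b \<in> S"
    and "b \<notin> Orbits.orbit p a"
  shows "num_cycles S p = Suc (num_cycles S (tp a b \<circ> p))"
proof -
  have perm: "permutation p" "permutation (tp a b \<circ> p)"
    using permutes_finite_permutation[OF _ fin] p transp_comp_permutes[OF p ab] by blast+
  have "num_classes S (gr p) = Suc (num_classes S (insert (a, b) (gr p)))"
    using assms perm(1) by (intro num_classes_insert fin ab) (simp add: mem_orbit_iff_conn)
  also have "num_classes S (insert (a, b) (gr p)) = num_classes S (gr (tp a b \<circ> p))"
    using conn_gr_transp_comp[OF perm(1) assms(5)] by (intro num_classes_conn_cong) simp
  finally show ?thesis by (simp add: num_cycles_eq_num_classes perm)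
qed

text \<open>A transposition is an involution: this is the joining case for
  \<open>tp a b \<circ> p\<close>, in which \<open>a\<close> and \<open>b\<close> have been
  separated.\<close>

lemma num_cycles_transp_comp_same:
  assumes "finite S" "p permutes S" "a \<in> S" "b \<in> S" "a \<noteq> b" "b \<in> Orbits.orbit p a"
  shows "num_cycles S (tp a b \<circ> p) = Suc (num_cycles S p)"
  using num_cycles_transp_comp_diff[OF assms(1) transp_comp_permutes[OF assms(2-4)] assms(3,4)]
    transp_comp_separates[OF assms(5,6)] by (simp add: o_assoc)

text \<open>Right multiplication becomes left multiplication of the inverse, which has the same
  cycles; so the right-hand versions below follow from the left-hand ones.\<close>

lemma comp_transp_eq_inv:
  assumes "bij p"
  shows "p \<circ> tp a b = inv' (tp a b \<circ> inv' p)"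
  using assms by (simp add: o_inv_distrib bij_imp_bij_inv inv_inv_eq)

lemma num_cycles_inv: "permutation p \<Longrightarrow> num_cycles S (inv' p) = num_cycles S p"
  by (simp add: num_cycles_def cycle_sets_def orbit_inv_eq)

lemma num_cycles_comp_transp:
  assumes "finite S" "p permutes S" "a \<in> S" "b \<in> S"
  shows "num_cycles S (p \<circ> tp a b) = num_cycles S (tp a b \<circ> inv' p)"
proof -
  have "tp a b \<circ> inv' p permutes S"
    using assms by (intro permutes_compose permutes_swap_id permutes_inv)
  then show ?thesis
    using assms by (simp add: comp_transp_eq_inv permutes_bij num_cycles_inv permutes_finite_permutation)
qed

lemma num_cycles_comp_transp_same:
  assumes "finite S" "p permutes S" "a \<in> S" "b \<in> S" "a \<noteq> b" "b \<in> Orbits.orbit p a"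
  shows "num_cycles S (p \<circ> tp a b) = Suc (num_cycles S p)"
  using num_cycles_transp_comp_same[OF assms(1) permutes_inv[OF assms(2)] assms(3-5)] assms
  by (simp add: num_cycles_comp_transp orbit_inv_eq num_cycles_inv permutes_finite_permutation)

lemma num_cycles_comp_transp_diff:
  assumes "finite S" "p permutes S" "a \<in> S" "b \<in> S" "b \<notin> Orbits.orbit p a"
  shows "num_cycles S p = Suc (num_cycles S (p \<circ> tp a b))"
  using num_cycles_transp_comp_diff[OF assms(1) permutes_inv[OF assms(2)] assms(3,4)] assms
  by (simp add: num_cycles_comp_transp orbit_inv_eq num_cycles_inv permutes_finite_permutation)

lemma conn_gr_comp_transp:
  assumes "permutation p" "b \<notin> Orbits.orbit p a"
  shows "conn (gr (p \<circ> tp a b)) = conn (insert (a, b) (gr p))"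
proof -
  have i: "permutation (inv' p)" using assms(1) by (rule permutation_inverse)
  have "conn (gr (p \<circ> tp a b)) = conn (gr (tp a b \<circ> inv' p))"
    using assms(1) i by (simp add: comp_transp_eq_inv permutation_bijective conn_gr_inv
        permutation_compose permutation_swap_id)
  also have "\<dots> = conn (insert (a, b) (gr (inv' p)))"
    using assms by (intro conn_gr_transp_comp i) (simp add: orbit_inv_eq)
  also have "\<dots> = conn (insert (a, b) (gr p))"
    using conn_Un_cong[OF refl conn_gr_inv[OF assms(1)], of "{(a, b)}"] by simp
  finally show ?thesis .
qed

section \<open>Refinements as geodesics\<close>

lemma num_cycles_id: "num_cycles S id = card S"
proof -
  have "Orbits.orbit id x = {x}" for x :: 'a by (simp add: orbit_eq_singleton_iff)
  then show ?thesis by (simp add: num_cycles_def cycle_sets_def card_image)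
qed

text \<open>The point \<open>i\<close> becomes fixed, and a point fixed by \<open>p\<close> is
  neither \<open>i\<close> nor, by injectivity, \<open>p i\<close>, so it stays fixed.\<close>

lemma moved_transp_comp_psubset:
  assumes "p permutes S" "finite S" "p i \<noteq> i"
  shows "{x. (tp i (p i) \<circ> p) x \<noteq> x} \<subset> {x. p x \<noteq> x}"
proof -
  have inj: "inj p" using assms(1) by (rule permutes_inj)
  have "(tp i (p i) \<circ> p) x = x" if "p x = x" for x
    using that assms(3) inj by (auto simp: Transposition.transpose_def inj_eq)
  moreover have "(tp i (p i) \<circ> p) i = i" by simp
  ultimately show ?thesis using assms(3) by blast
qed

text \<open>Amounts to a factorisation into transpositions. Each removed factor joins
  \<open>i\<close> to \<open>p i\<close> within one cycle, so removing it splits that cycle and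
  raises the cycle count by exactly one.\<close>

lemma permutation_moved_induct [consumes 2, case_names id step]:
  assumes "finite S" "p permutes S"
    and "P id"
    and "\<And>p i. p permutes S \<Longrightarrow> i \<in> S \<Longrightarrow> p i \<in> S \<Longrightarrow> p i \<noteq> i \<Longrightarrow> P (tp i (p i) \<circ> p) \<Longrightarrow> P p"
  shows "P p"
  using assms(2)
proof (induction "card {x. p x \<noteq> x}" arbitrary: p rule: less_induct)
  case less
  show ?case
  proof (cases "p = id")
    case True
    then show ?thesis using assms(3) by simp
  next
    case False
    then obtain i where i: "p i \<noteq> i" by (auto simp: fun_eq_iff)
    have "i \<in> S" using i less.prems by (meson permutes_not_in)
    then have "p i \<in> S" using less.prems by (simp add: permutes_in_image)
    have "finite {x. p x \<noteq> x}"
      using assms(1) less.prems by (rule_tac finite_subset[of _ S]) (auto dest: permutes_not_in)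
    then have "card {x. (tp i (p i) \<circ> p) x \<noteq> x} < card {x. p x \<noteq> x}"
      using moved_transp_comp_psubset[OF less.prems assms(1) i] by (rule psubset_card_mono)
    then have "P (tp i (p i) \<circ> p)"
      using less.hyps transp_comp_permutes[OF less.prems \<open>i \<in> S\<close> \<open>p i \<in> S\<close>] by blast
    then show ?thesis using assms(4) less.prems \<open>i \<in> S\<close> \<open>p i \<in> S\<close> i by blast
  qed
qed

text \<open>
  The equality case says that every transposition used in building \<open>\<beta> \<circ> \<gamma>\<close> from \<open>\<beta>\<close> merges two
  cycles, so the cycles of \<open>\<beta>\<close> lie inside those of the product.
\<close>

lemma num_cycles_comp_le:
  assumes "finite S" "\<beta> permutes S" "\<gamma> permutes S"
  shows "num_cycles S \<beta> + num_cycles S \<gamma> \<le> card S + num_cycles S (\<beta> \<circ> \<gamma>) \<and>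
    (num_cycles S \<beta> + num_cycles S \<gamma> = card S + num_cycles S (\<beta> \<circ> \<gamma>) \<longrightarrow>
       gr \<beta> \<subseteq> conn (gr (\<beta> \<circ> \<gamma>)))"
  using assms(1,3,2)
proof (induction \<gamma> arbitrary: \<beta> rule: permutation_moved_induct)
  case id
  show ?case by (simp only: num_cycles_id comp_id) (simp add: gr_subset_conn_iff)
next
  case (step \<gamma> i)
  let ?t = "tp i (\<gamma> i)" and ?z = "num_cycles S"
  have \<beta>t: "\<beta> \<circ> ?t permutes S"
    using comp_transp_permutes[OF \<open>\<beta> permutes S\<close>] step.hyps by blast
  \<comment> \<open>The transposition moves from \<open>\<gamma>\<close> over to
    \<open>\<beta>\<close>; the product is unchanged, so the induction hypothesis speaks of the same
    right-hand side.\<close>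
  have \<beta>\<gamma>: "(\<beta> \<circ> ?t) \<circ> (?t \<circ> \<gamma>) = \<beta> \<circ> \<gamma>" by (simp add: fun_eq_iff)
  have IH: "?z (\<beta> \<circ> ?t) + ?z (?t \<circ> \<gamma>) \<le> card S + ?z (\<beta> \<circ> \<gamma>)"
    "?z (\<beta> \<circ> ?t) + ?z (?t \<circ> \<gamma>) = card S + ?z (\<beta> \<circ> \<gamma>) \<Longrightarrow> gr (\<beta> \<circ> ?t) \<subseteq> conn (gr (\<beta> \<circ> \<gamma>))"
    using step.IH[OF \<beta>t] unfolding \<beta>\<gamma> by blast+
  have z\<gamma>: "?z (?t \<circ> \<gamma>) = Suc (?z \<gamma>)"
    using step.hyps assms(1) by (intro num_cycles_transp_comp_same) (auto intro: orbit.base)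
  have "?z \<beta> + ?z \<gamma> \<le> card S + ?z (\<beta> \<circ> \<gamma>) \<and>
    (?z \<beta> + ?z \<gamma> = card S + ?z (\<beta> \<circ> \<gamma>) \<longrightarrow> gr \<beta> \<subseteq> conn (gr (\<beta> \<circ> \<gamma>)))"
  proof (cases "\<gamma> i \<in> Orbits.orbit \<beta> i")
    \<comment> \<open>A cycle of \<open>\<beta>\<close> is split here, which makes the inequality
      strict, so the equality claim is vacuous.\<close>
    case True
    then have "?z (\<beta> \<circ> ?t) = Suc (?z \<beta>)"
      using step.hyps step.prems assms(1) by (intro num_cycles_comp_transp_same) auto
    then show ?thesis using IH(1) z\<gamma> by simp
  next
    case False
    then have z\<beta>: "?z \<beta> = Suc (?z (\<beta> \<circ> ?t))"
      using step.hyps step.prems assms(1) by (intro num_cycles_comp_transp_diff) auto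
    have "gr \<beta> \<subseteq> conn (insert (i, \<gamma> i) (gr \<beta>))" by (auto intro: conn_incl)
    also have "\<dots> = conn (gr (\<beta> \<circ> ?t))"
      using conn_gr_comp_transp False step.prems assms(1) permutes_finite_permutation by metis
    finally have "gr (\<beta> \<circ> ?t) \<subseteq> conn (gr (\<beta> \<circ> \<gamma>)) \<Longrightarrow> gr \<beta> \<subseteq> conn (gr (\<beta> \<circ> \<gamma>))"
      using conn_subsetI by blast
    then show ?thesis using IH z\<gamma> z\<beta> by simp
  qed
  then show ?case .
qed

text \<open>Equality holds at \<open>\<beta> = id\<close>. Each further transposition lowers the
  number of cycles of \<open>\<beta>\<close> by one and the number of components by at most one. The
  bound shows that the exponent of \<open>v\<close> does not truncate.\<close>

lemma num_cycles_sum_le: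
  assumes "finite S" "\<sigma> permutes S" "\<beta> permutes S"
  shows "num_cycles S \<sigma> + num_cycles S \<beta> \<le> num_classes S (gr \<sigma> \<union> gr \<beta>) + card S"
  using assms(1,3)
proof (induction \<beta> rule: permutation_moved_induct)
  case id
  have "conn (gr \<sigma>) = conn (gr \<sigma> \<union> gr id)"
    by (intro conn_eqI) (auto simp: gr_def intro: conn_incl)
  from num_classes_conn_cong[OF this, of S]
  have "num_cycles S \<sigma> = num_classes S (gr \<sigma> \<union> gr id)"
    using num_cycles_eq_num_classes[OF permutes_finite_permutation[OF assms(2,1)]] by metis
  then show ?case by (simp only: num_cycles_id)
next
  case (step \<beta> i)
  let ?t = "tp i (\<beta> i)" and ?Q = "\<lambda>\<beta>. gr \<sigma> \<union> gr \<beta>"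
  have "(i, \<beta> i) \<in> ?Q \<beta>" by (auto simp: gr_def)
  then have "num_classes S (insert (i, \<beta> i) (?Q (?t \<circ> \<beta>))) = num_classes S (?Q \<beta>)"
    using conn_insert_transp[of i "\<beta> i" \<beta> "gr \<sigma>"]
    by (intro num_classes_conn_cong) (simp add: insert_absorb Un_commute)
  then have "num_classes S (?Q (?t \<circ> \<beta>)) \<le> Suc (num_classes S (?Q \<beta>))"
    using num_classes_le_insert(1)[OF assms(1) step.hyps(2,3)] by metis
  moreover have "num_cycles S (?t \<circ> \<beta>) = Suc (num_cycles S \<beta>)"
    using step.hyps assms(1) by (intro num_cycles_transp_comp_same) (auto intro: orbit.base)
  moreover have "num_cycles S \<sigma> + num_cycles S (?t \<circ> \<beta>) \<le> num_classes S (?Q (?t \<circ> \<beta>)) + card S"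
    by (rule step.IH)
  ultimately have "num_cycles S \<sigma> + num_cycles S \<beta> \<le> num_classes S (?Q \<beta>) + card S" by simp
  then show ?case .
qed

section \<open>From the genus condition on each cycle to one global equation\<close>

lemma perm_restrict_permutes:
  assumes "p permutes S" "finite C" "p ` C \<subseteq> C"
  shows "perm_restrict p C permutes C"
proof (rule bij_imp_permutes)
  have inj: "inj_on p C" using assms(1) by (meson permutes_inj inj_on_subset subset_UNIV)
  then have "bij_betw p C C" using assms(2,3) by (simp add: bij_betw_def endo_inj_surj)
  then show "bij_betw (perm_restrict p C) C C"
    by (simp add: perm_restrict_def cong: bij_betw_cong)
qed (simp add: perm_restrict_def)

lemma orbit_perm_restrict:
  assumes "x \<in> C" "p ` C \<subseteq> C"
  shows "Orbits.orbit (perm_restrict p C) x = Orbits.orbit p x"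
  by (rule orbit_cong0[of _ C]) (use assms in \<open>auto simp: perm_restrict_def\<close>)

lemma cycle_sets_partition:
  assumes "finite S" "\<alpha> permutes S"
  shows "\<Union>(cycle_sets S \<alpha>) = S" "disjoint (cycle_sets S \<alpha>)"
proof -
  have \<alpha>: "permutation \<alpha>" using assms by (simp add: permutes_finite_permutation)
  show "\<Union>(cycle_sets S \<alpha>) = S"
    using permutes_orbit_subset[OF assms(2)] permutation_self_in_orbit[OF \<alpha>]
    by (fastforce simp: cycle_sets_def)
  show "disjoint (cycle_sets S \<alpha>)"
    unfolding disjoint_def cycle_sets_def
  proof (clarify, rule ccontr)
    fix x y assume "Orbits.orbit \<alpha> x \<noteq> Orbits.orbit \<alpha> y" "Orbits.orbit \<alpha> x \<inter> Orbits.orbit \<alpha> y \<noteq> {}"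
    then show False
      by (metis \<alpha> cyclic_on_orbit' disjoint_iff orbit_cyclic_eq3)
  qed
qed

text \<open>Every cycle lies in a single invariant block, and cycles are nonempty, so distinct
  blocks contribute disjoint families of cycles.\<close>

lemma num_cycles_sum_blocks:
  assumes "finite S" "disjoint P" "\<Union>P = S" and inv: "\<And>C. C \<in> P \<Longrightarrow> p ` C \<subseteq> C"
  shows "num_cycles S p = (\<Sum>C\<in>P. num_cycles C (perm_restrict p C))"
proof -
  have fin: "finite P" "\<And>C. C \<in> P \<Longrightarrow> finite C"
    using assms(1,3) by (auto intro: finite_UnionD finite_subset)
  have cs: "cycle_sets C (perm_restrict p C) = Orbits.orbit p ` C" if "C \<in> P" for C
    unfolding cycle_sets_def by (intro image_cong refl orbit_perm_restrict inv that)
  have sub: "X \<subseteq> C" if "C \<in> P" "X \<in> Orbits.orbit p ` C" for C X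
  proof -
    from that(2) obtain x where x: "x \<in> C" "X = Orbits.orbit p x" by blast
    have "y \<in> C" if "y \<in> Orbits.orbit p x" for y
      using that by induction (use inv[OF \<open>C \<in> P\<close>] x in auto)
    then show ?thesis using x by blast
  qed
  have "cycle_sets S p = (\<Union>C\<in>P. Orbits.orbit p ` C)"
    using assms(3) by (auto simp: cycle_sets_def)
  also have "card \<dots> = (\<Sum>C\<in>P. card (Orbits.orbit p ` C))"
  proof (intro card_UN_disjoint fin(1) ballI impI)
    fix C D assume CD: "C \<in> P" "D \<in> P" "C \<noteq> D"
    then have "C \<inter> D = {}" using assms(2) by (auto simp: disjoint_def)
    then show "Orbits.orbit p ` C \<inter> Orbits.orbit p ` D = {}"
    proof (intro equals0I, elim IntE)
      fix X assume X: "X \<in> Orbits.orbit p ` C" "X \<in> Orbits.orbit p ` D"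
      then have "X \<subseteq> C" "X \<subseteq> D" "X \<noteq> {}"
        using sub[OF CD(1) X(1)] sub[OF CD(2) X(2)] X(1) orbit_nonempty[of p] by blast+
      then show False using \<open>C \<inter> D = {}\<close> by blast
    qed
  qed (use fin in auto)
  finally show ?thesis by (simp add: num_cycles_def cs)
qed

text \<open>\<open>\<alpha>\<close> has one cycle on each block, so the global equation is the sum
  of the genus equations. Each summand satisfies the inequality of
  \<open>num_cycles_comp_le\<close>, hence equality of the sums is equality in every block.\<close>

lemma refinement_iff:
  assumes "finite S" and \<alpha>: "\<alpha> permutes S"
  shows "refinement S \<beta> \<alpha> \<longleftrightarrow> \<beta> permutes S \<and>
    num_cycles S \<beta> + num_cycles S (inv' \<beta> \<circ> \<alpha>) = card S + num_cycles S \<alpha>"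
    (is "_ \<longleftrightarrow> _ \<and> ?eq")
proof (cases "\<beta> permutes S")
  case False
  then show ?thesis by (simp add: refinement_def)
next
  case \<beta>: True
  let ?P = "cycle_sets S \<alpha>" and ?\<gamma> = "inv' \<beta> \<circ> \<alpha>"
  note P = cycle_sets_partition[OF assms]
  have \<alpha>': "permutation \<alpha>" using assms by (simp add: permutes_finite_permutation)
  have fin: "finite ?P" "\<And>C. C \<in> ?P \<Longrightarrow> finite C"
    using P(1) assms(1) by (auto intro: finite_UnionD finite_subset)
  have \<alpha>C: "\<alpha> ` C \<subseteq> C" if "C \<in> ?P" for C
    using that by (auto simp: cycle_sets_def intro: orbit.step)
  have \<beta>\<gamma>: "\<beta> \<circ> ?\<gamma> = \<alpha>" using permutes_inv_o(1)[OF \<beta>] by (simp add: o_assoc)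
  have one: "num_cycles C (perm_restrict \<alpha> C) = 1" if C: "C \<in> ?P" for C
  proof -
    obtain x where x: "x \<in> S" "C = Orbits.orbit \<alpha> x" using C by (auto simp: cycle_sets_def)
    then have "Orbits.orbit (perm_restrict \<alpha> C) y = C" if "y \<in> C" for y
      using that orbit_perm_restrict[OF that \<alpha>C[OF C]]
        cyclic_on_orbit'[OF \<alpha>', of x] orbit_cyclic_eq3 by metis
    then have "cycle_sets C (perm_restrict \<alpha> C) = {C}"
      using x orbit_nonempty[of \<alpha> x] by (auto simp: cycle_sets_def)
    then show ?thesis by (simp add: num_cycles_def)
  qed
  let ?s = "\<lambda>C. num_cycles C (perm_restrict \<beta> C) + num_cycles C (perm_restrict ?\<gamma> C)"
  have key: "num_cycles S \<beta> + num_cycles S ?\<gamma> = (\<Sum>C\<in>?P. ?s C)"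
      "card S + num_cycles S \<alpha> = (\<Sum>C\<in>?P. card C + 1)"
      "\<And>C. C \<in> ?P \<Longrightarrow> ?s C \<le> card C + 1"
      "\<And>C. C \<in> ?P \<Longrightarrow> inv' (perm_restrict \<beta> C) \<circ> perm_restrict \<alpha> C = perm_restrict ?\<gamma> C"
    if \<beta>C: "\<And>C. C \<in> ?P \<Longrightarrow> perm_restrict \<beta> C permutes C"
  proof -
    have \<beta>C': "\<beta> ` C \<subseteq> C" if "C \<in> ?P" for C
      using permutes_image[OF \<beta>C[OF that]] by (auto simp: perm_restrict_def cong: image_cong)
    show g: "inv' (perm_restrict \<beta> C) \<circ> perm_restrict \<alpha> C = perm_restrict ?\<gamma> C" if C: "C \<in> ?P" for C
    proof
      fix x
      note b = \<beta>C[OF C]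
      show "(inv' (perm_restrict \<beta> C) \<circ> perm_restrict \<alpha> C) x = perm_restrict ?\<gamma> C x"
      proof (cases "x \<in> C")
        case True
        then have "\<alpha> x \<in> C" using \<alpha>C[OF C] by blast
        then have *: "inv' (perm_restrict \<beta> C) (\<alpha> x) \<in> C"
          using permutes_in_image[OF permutes_inv[OF b]] by blast
        then have "\<beta> (inv' (perm_restrict \<beta> C) (\<alpha> x)) = \<alpha> x"
          using permutes_inverses(1)[OF b, of "\<alpha> x"] by (simp add: perm_restrict_def)
        \<comment> \<open>Both sides are preimages of \<open>\<alpha> x\<close> under
          \<open>\<beta>\<close>, which is injective.\<close>
        then have "inv' (perm_restrict \<beta> C) (\<alpha> x) = inv' \<beta> (\<alpha> x)"
          using permutes_inverses(2)[OF \<beta>] by metis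
        then show ?thesis using True by (simp add: perm_restrict_def)
      next
        case False
        then show ?thesis using permutes_not_in[OF permutes_inv[OF b]] by (simp add: perm_restrict_def)
      qed
    qed
    have \<alpha>p: "perm_restrict \<alpha> C permutes C" if "C \<in> ?P" for C
      using that \<alpha>C \<alpha> fin(2) by (intro perm_restrict_permutes)
    have \<gamma>p: "perm_restrict ?\<gamma> C permutes C" if C: "C \<in> ?P" for C
      unfolding g[OF C, symmetric] by (intro permutes_compose \<alpha>p permutes_inv \<beta>C C)
    have \<gamma>C: "?\<gamma> ` C \<subseteq> C" if "C \<in> ?P" for C
      using permutes_image[OF \<gamma>p[OF that]] by (auto simp: perm_restrict_def cong: image_cong)
    show "num_cycles S \<beta> + num_cycles S ?\<gamma> = (\<Sum>C\<in>?P. ?s C)"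
      using num_cycles_sum_blocks[OF assms(1) P(2,1)] \<beta>C' \<gamma>C by (simp add: sum.distrib)
    have "card S = (\<Sum>C\<in>?P. card C)"
      using card_Union_disjoint[OF P(2)] fin P(1) by auto
    moreover have "num_cycles S \<alpha> = (\<Sum>C\<in>?P. 1)" by (simp add: num_cycles_def)
    ultimately show "card S + num_cycles S \<alpha> = (\<Sum>C\<in>?P. card C + 1)"
      by (simp only: sum.distrib)
    show "?s C \<le> card C + 1" if C: "C \<in> ?P" for C
    proof -
      have "perm_restrict \<beta> C \<circ> perm_restrict ?\<gamma> C = perm_restrict \<alpha> C"
        unfolding g[OF C, symmetric] o_assoc permutes_inv_o(1)[OF \<beta>C[OF C]] by simp
      then show ?thesis
        using num_cycles_comp_le[OF fin(2)[OF C] \<beta>C[OF C] \<gamma>p[OF C]] one[OF C] by simp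
    qed
  qed
  show ?thesis
  proof
    assume r: "refinement S \<beta> \<alpha>"
    then have b: "perm_restrict \<beta> C permutes C" if "C \<in> ?P" for C
      using that by (auto simp: refinement_def)
    have "?s C = card C + 1" if "C \<in> ?P" for C
      using r that key(4)[OF b that] by (auto simp: refinement_def)
    then show "\<beta> permutes S \<and> ?eq" using key(1,2)[OF b] \<beta> by simp
  next
    assume "\<beta> permutes S \<and> ?eq"
    then have eq: ?eq by simp
    have "?\<gamma> permutes S" using \<alpha> \<beta> by (intro permutes_compose permutes_inv)
    \<comment> \<open>The global equation alone forces \<open>\<beta>\<close> to preserve the cycles
      of \<open>\<alpha>\<close>: this is the equality case of \<open>num_cycles_comp_le\<close>.
      Only now is it legitimate to restrict \<open>\<beta>\<close> to blocks.\<close>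
    then have "gr \<beta> \<subseteq> conn (gr \<alpha>)"
      using num_cycles_comp_le[OF assms(1) \<beta>, of ?\<gamma>] eq \<beta>\<gamma> by simp
    then have "\<beta> x \<in> Orbits.orbit \<alpha> x" for x
      by (simp add: mem_orbit_iff_conn[OF \<alpha>'] gr_subset_conn_iff)
    then have "\<beta> ` C \<subseteq> C" if "C \<in> ?P" for C
      using that by (auto simp: cycle_sets_def intro: orbit_trans)
    then have b: "perm_restrict \<beta> C permutes C" if "C \<in> ?P" for C
      using that \<beta> fin(2) by (intro perm_restrict_permutes)
    have "?s C = card C + 1" if "C \<in> ?P" for C
      using key(1-3)[OF b] eq that fin(1) by (intro sum_mono_inv[of ?s ?P]) auto
    then show "refinement S \<beta> \<alpha>"
      using \<beta> b key(4)[OF b] by (auto simp: refinement_def)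
  qed
qed

lemma refinement_imp_conn:
  assumes "finite S" "\<alpha> permutes S" "refinement S \<beta> \<alpha>"
  shows "gr \<beta> \<subseteq> conn (gr \<alpha>)"
proof -
  have \<beta>: "\<beta> permutes S" using assms(3) by (simp add: refinement_def)
  have "\<beta> \<circ> (inv' \<beta> \<circ> \<alpha>) = \<alpha>" using permutes_inv_o(1)[OF \<beta>] by (simp add: o_assoc)
  moreover have "inv' \<beta> \<circ> \<alpha> permutes S" using assms(2) \<beta> by (intro permutes_compose permutes_inv)
  ultimately show ?thesis
    using num_cycles_comp_le[OF assms(1) \<beta>, of "inv' \<beta> \<circ> \<alpha>"] assms by (simp add: refinement_iff)
qed

section \<open>Splitting the Whitney polynomial at a point\<close>

text \<open>Elements of the generated group are words in the two permutations and their inverses,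
  and such words trace exactly the walks along the two graphs.\<close>

lemma num_components_eq:
  assumes "\<sigma> permutes {1..n}" "\<beta> permutes {1..n}"
  shows "num_components n (\<sigma>, \<beta>) = num_classes {1..n} (gr \<sigma> \<union> gr \<beta>)"
proof -
  let ?G = "sym_group n" and ?R = "gr \<sigma> \<union> gr \<beta>"
  interpret group ?G by (rule sym_group_is_group)
  have H: "{\<sigma>, \<beta>} \<subseteq> carrier ?G" using assms by (simp add: sym_group_carrier)
  have invG: "inv\<^bsub>?G\<^esub> p = inv' p" if "p permutes {1..n}" for p
    using that permutes_inv_o(2)[OF that] permutes_inv[OF that]
    by (intro inv_equality) (auto simp: sym_group_def)
  have p: "permutation p" if "p \<in> {\<sigma>, \<beta>}" for p
    using that assms by (auto intro: permutes_finite_permutation)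
  have sub: "conn (gr p) \<subseteq> conn ?R" if "p \<in> {\<sigma>, \<beta>}" for p
    using that by (intro conn_mono) auto
  have 1: "(x, g x) \<in> conn ?R" if "g \<in> generate ?G {\<sigma>, \<beta>}" for g x
    using that
  proof (induction arbitrary: x)
    case one
    then show ?case by (simp add: sym_group_one)
  next
    case (incl h)
    then show ?case using subsetD[OF sub[OF incl] gr_conn[of x h]] by blast
  next
    case (inv h)
    have "(x, inv' h x) \<in> conn (gr h)"
      using gr_conn[of x "inv' h"] unfolding conn_gr_inv[OF p[OF inv]] .
    moreover have "inv\<^bsub>?G\<^esub> h = inv' h" using inv assms by (intro invG) auto
    ultimately show ?case using subsetD[OF sub[OF inv]] by simp
  next
    case (eng h1 h2)
    then show ?case by (auto simp: sym_group_mult intro: conn_trans)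
  qed
  have 2: "\<exists>g\<in>generate ?G {\<sigma>, \<beta>}. y = g x" if "(x, y) \<in> conn ?R" for x y
    using that
  proof (induction rule: conn_induct)
    case refl
    have "id \<in> generate ?G {\<sigma>, \<beta>}"
      using generate.one[of ?G "{\<sigma>, \<beta>}"] by (simp only: sym_group_one)
    then show ?case by (intro bexI[of _ id]) simp_all
  next
    case (step y z)
    then obtain g h where gh: "g \<in> generate ?G {\<sigma>, \<beta>}" "y = g x" "h \<in> {\<sigma>, \<beta>}" "z = h y"
      by (auto simp: gr_def)
    have "h \<circ> g \<in> generate ?G {\<sigma>, \<beta>}"
      using generate.eng[OF generate.incl[OF gh(3)] gh(1)] by (simp only: sym_group_mult)
    then show ?case using gh by (intro bexI[of _ "h \<circ> g"]) simp_all
  next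
    case (step_conv y z)
    then obtain g h where gh: "g \<in> generate ?G {\<sigma>, \<beta>}" "y = g x" "h \<in> {\<sigma>, \<beta>}" "y = h z"
      by (auto simp: gr_def)
    have hp: "h permutes {1..n}" using gh(3) assms by auto
    then have "z = inv' h (g x)" using gh permutes_inverses(2) by metis
    moreover have "inv' h \<circ> g \<in> generate ?G {\<sigma>, \<beta>}"
      using generate.eng[OF generate.inv[OF gh(3)] gh(1)] by (simp only: sym_group_mult invG[OF hp])
    ultimately show ?case by (intro bexI[of _ "inv' h \<circ> g"]) simp_all
  qed
  have "Group_Action.orbit (perm_group n (\<sigma>, \<beta>)) id x = conn ?R `` {x}" for x
  proof (intro equalityI subsetI)
    fix y assume "y \<in> Group_Action.orbit (perm_group n (\<sigma>, \<beta>)) id x"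
    then obtain g where "g \<in> generate ?G {\<sigma>, \<beta>}" "y = g x"
      unfolding Group_Action.orbit_def perm_group_def by auto
    then show "y \<in> conn ?R `` {x}" using 1 by simp
  next
    fix y assume "y \<in> conn ?R `` {x}"
    then obtain g where "g \<in> generate ?G {\<sigma>, \<beta>}" "y = g x" using 2[of x y] by auto
    then show "y \<in> Group_Action.orbit (perm_group n (\<sigma>, \<beta>)) id x"
      unfolding Group_Action.orbit_def perm_group_def by auto
  qed
  then show ?thesis
    unfolding num_components_def Group_Action.orbits_def num_classes_def
    by (auto intro!: arg_cong[where f = card])
qed

text \<open>Keeps the base point \<open>1\<close> from being rewritten to \<open>Suc 0\<close>, so
  that facts about it still match.\<close>

declare One_nat_def [simp del]

lemma conn_transp_absorb:
  assumes "(a, b) \<in> conn R"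
  shows "conn (gr (tp a b \<circ> p) \<union> R) = conn (gr p \<union> R)"
proof -
  have "(a, b) \<in> conn (gr q \<union> R)" for q :: "'a \<Rightarrow> 'a"
    using assms conn_mono[of R "gr q \<union> R"] by blast
  then show ?thesis using conn_insert_transp[of a b p R] by (simp only: conn_insert_absorb)
qed

text \<open>For a refinement \<open>\<beta>\<close> the components of
  \<open>(\<sigma>, \<beta>)\<close> lie inside those of \<open>(\<sigma>, \<alpha>)\<close>, so
  \<open>a\<close> and \<open>b\<close> are separated there too. The transposition thus lowers both
  component numbers and the cycle number of \<open>\<sigma>\<close> by one, and both exponents are
  unchanged.\<close>

lemma whitney_merge:
  assumes \<sigma>: "\<sigma> permutes {1..n}" and \<alpha>: "\<alpha> permutes {1..n}" and ab: "a \<in> {1..n}" "b \<in> {1..n}"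
    and nc: "(a, b) \<notin> conn (gr \<sigma> \<union> gr \<alpha>)"
  shows "whitney n (transp a b \<circ> \<sigma>, \<alpha>) u v = whitney n (\<sigma>, \<alpha>) u v"
proof -
  let ?\<tau> = "tp a b \<circ> \<sigma>"
  have \<tau>: "?\<tau> permutes {1..n}" using transp_comp_permutes[OF \<sigma> ab] .
  have p: "permutation \<sigma>" using \<sigma> by (simp add: permutes_finite_permutation)
  have "conn (gr \<sigma>) \<subseteq> conn (gr \<sigma> \<union> gr \<alpha>)" by (intro conn_mono) auto
  then have orb: "b \<notin> Orbits.orbit \<sigma> a"
    using nc unfolding mem_orbit_iff_conn[OF p] by blast
  have z: "num_cycles {1..n} \<sigma> = Suc (num_cycles {1..n} ?\<tau>)"
    using \<sigma> ab orb by (intro num_cycles_transp_comp_diff) auto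
  have \<kappa>: "num_components n (\<sigma>, \<beta>) = Suc (num_components n (?\<tau>, \<beta>))"
    if \<beta>: "\<beta> permutes {1..n}" and sub: "gr \<beta> \<subseteq> conn (gr \<alpha>)" for \<beta>
  proof -
    have "conn (gr \<sigma> \<union> gr \<beta>) \<subseteq> conn (gr \<sigma> \<union> gr \<alpha>)"
    proof (intro conn_subsetI Un_least)
      show "gr \<sigma> \<subseteq> conn (gr \<sigma> \<union> gr \<alpha>)" by (auto intro: conn_incl)
      show "gr \<beta> \<subseteq> conn (gr \<sigma> \<union> gr \<alpha>)"
        using sub conn_mono[of "gr \<alpha>" "gr \<sigma> \<union> gr \<alpha>"] by blast
    qed
    then have "(a, b) \<notin> conn (gr \<sigma> \<union> gr \<beta>)" using nc by blast
    then have "num_classes {1..n} (gr \<sigma> \<union> gr \<beta>) =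
        Suc (num_classes {1..n} (insert (a, b) (gr \<sigma> \<union> gr \<beta>)))"
      using ab by (intro num_classes_insert) auto
    also have "conn (insert (a, b) (gr \<sigma> \<union> gr \<beta>)) = conn (gr ?\<tau> \<union> gr \<beta>)"
      using conn_Un_cong[OF conn_gr_transp_comp[OF p orb] refl, of "gr \<beta>"] by simp
    from num_classes_conn_cong[OF this]
    have "num_classes {1..n} (insert (a, b) (gr \<sigma> \<union> gr \<beta>)) = num_classes {1..n} (gr ?\<tau> \<union> gr \<beta>)" .
    finally show ?thesis by (simp only: num_components_eq \<sigma> \<beta> \<tau>)
  qed
  have \<alpha>': "num_components n (\<sigma>, \<alpha>) = Suc (num_components n (?\<tau>, \<alpha>))"
    by (rule \<kappa>[OF \<alpha>]) (auto intro: conn_incl)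
  have "num_components n (\<sigma>, \<beta>) = Suc (num_components n (?\<tau>, \<beta>))" if "refinement {1..n} \<beta> \<alpha>" for \<beta>
    using that refinement_imp_conn[OF _ \<alpha> that] by (intro \<kappa>) (auto simp: refinement_def)
  then show ?thesis
    unfolding whitney_def prod.case by (intro sum.cong refl) (simp add: \<alpha>' z)
qed

lemma cycle_of_list_upt:
  "cycle_of_list [a..<b] i = (if a \<le> i \<and> i < b then if Suc i = b then a else Suc i else i)"
proof (cases "a \<le> i \<and> i < b")
  case True
  let ?cs = "[a..<b]"
  have "map (cycle_of_list ?cs) ?cs = rotate1 ?cs" using cyclic_rotation[of ?cs "Suc 0"] by simp
  then have "cycle_of_list ?cs (?cs ! (i - a)) = rotate1 ?cs ! (i - a)"
    using True by (metis diff_less_mono length_upt nth_map)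
  also have "\<dots> = ?cs ! (Suc (i - a) mod (b - a))"
    using True by (subst nth_rotate1) (auto intro: diff_less_mono)
  finally show ?thesis using True by (cases "Suc i = b") (auto simp: Suc_diff_le[symmetric])
next
  case False
  then show ?thesis by (auto intro: id_outside_supp)
qed

text \<open>Conjugation relabels a transposition; this carries factors from the right of
  \<open>\<alpha>\<close> to its left.\<close>

lemma comp_transp_conj:
  assumes "inj p"
  shows "p \<circ> tp a b = tp (p a) (p b) \<circ> p"
  using assms by (auto simp: fun_eq_iff Transposition.transpose_def inj_eq)

section \<open>A marked cycle \<open>(1, ..., m)\<close> and the pairs obtained by detaching the
  point \<open>1\<close>\<close>

locale pointed_hypermaps =
  fixes n m :: nat and \<sigma> \<alpha> :: "nat \<Rightarrow> nat"
  assumes \<sigma>: "\<sigma> permutes {1..n}" and \<alpha>: "\<alpha> permutes {1..n}"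
    and m: "2 \<le> m" and cyc: "list_is_cycle \<alpha> [1..<m + 1]"
begin

lemma \<alpha>_cycle: "1 \<le> i \<Longrightarrow> i \<le> m \<Longrightarrow> \<alpha> i = (if i = m then 1 else Suc i)"
  using cyc unfolding list_is_cycle_def cycle_of_list_upt by auto

lemma \<alpha>_1: "\<alpha> 1 = 2"
  using \<alpha>_cycle[of 1] m by (simp add: Suc_1)

lemma m_le_n: "m \<le> n"
proof -
  have "\<alpha> m \<noteq> m" using \<alpha>_cycle[of m] m by simp
  then have "m \<in> {1..n}" using \<alpha> by (meson permutes_not_in)
  then show ?thesis by simp
qed

lemma inj_\<alpha>: "inj \<alpha>"
  using \<alpha> by (rule permutes_inj)

lemma \<alpha>_outside: "i \<notin> {1..m} \<Longrightarrow> \<alpha> i \<notin> {1..m}"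
proof
  assume i: "i \<notin> {1..m}" "\<alpha> i \<in> {1..m}"
  \<comment> \<open>The predecessor of \<open>\<alpha> i\<close> on the marked cycle; injectivity
    would make it equal to \<open>i\<close>.\<close>
  define j where "j = (if \<alpha> i = 1 then m else \<alpha> i - 1)"
  have "1 \<le> j" "j \<le> m" "\<alpha> j = \<alpha> i" using i(2) m \<alpha>_cycle[of j] by (auto simp: j_def)
  then show False using inj_\<alpha> i(1) by (auto simp: inj_eq)
qed

lemma conn_\<alpha>: "i \<in> {1..m} \<Longrightarrow> (1, i) \<in> conn (gr \<alpha>)"
proof (induction i)
  case (Suc i)
  show ?case
  proof (cases "i = 0")
    case False
    then have "(1, i) \<in> conn (gr \<alpha>)" "\<alpha> i = Suc i" using Suc \<alpha>_cycle[of i] by auto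
    then show ?thesis using conn_trans[OF _ gr_conn[of i \<alpha>]] by metis
  qed (simp add: One_nat_def)
qed simp

lemma orbit_\<alpha>: "Orbits.orbit \<alpha> 1 \<subseteq> {1..m}"
proof
  fix y assume "y \<in> Orbits.orbit \<alpha> 1"
  then show "y \<in> {1..m}"
    by induction (use m \<alpha>_cycle in auto)
qed

definition \<sigma>\<^sub>k :: "nat \<Rightarrow> nat \<Rightarrow> nat" where
  "\<sigma>\<^sub>k k = (if same_cycle \<sigma> 1 k then \<sigma> else tp 1 k \<circ> \<sigma>)"

text \<open>A product form suited to counting cycles. For \<open>k \<ge> 3\<close> the right factor
  cuts the marked cycle into \<open>(1, k, ..., m)\<close> and \<open>(2, ..., k - 1)\<close>, and
  the left factor detaches \<open>1\<close>; for \<open>k = 1\<close> and \<open>k = 2\<close> one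
  of the factors is the identity.\<close>

definition \<alpha>\<^sub>k :: "nat \<Rightarrow> nat \<Rightarrow> nat" where
  "\<alpha>\<^sub>k k = tp 1 k \<circ> (\<alpha> \<circ> tp 1 (cyc_pred m k))"

context
  fixes k
  assumes k: "k \<in> {1..m}"
begin

lemma cyc_pred_mem: "cyc_pred m k \<in> {1..m}"
  using k m by (auto simp: cyc_pred_def)

lemma \<alpha>_cyc_pred [simp]: "\<alpha> (cyc_pred m k) = k"
  using k m \<alpha>_cycle[of "cyc_pred m k"] by (auto simp: cyc_pred_def)

lemma in_points: "1 \<in> {1..n}" "2 \<in> {1..n}" "k \<in> {1..n}" "cyc_pred m k \<in> {1..n}" "m \<in> {1..n}"
  using k m cyc_pred_mem m_le_n by auto

lemma phi_eq: "phi m k (\<sigma>, \<alpha>) = (\<sigma>\<^sub>k k, \<alpha>\<^sub>k k)"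
proof -
  have "(if i \<notin> {1..m} then \<alpha> i
        else if k \<in> {1, 2} then cycle_of_list [2..<m + 1] i
        else (cycle_of_list [2..<k] \<circ> cycle_of_list [k..<m + 1]) i) = \<alpha>\<^sub>k k i" for i
  proof (cases "i \<in> {1..m}")
    case False
    then have "\<alpha> i \<noteq> 1" "\<alpha> i \<noteq> k" "i \<noteq> 1" "i \<noteq> cyc_pred m k"
      using \<alpha>_outside[OF False] k m cyc_pred_mem by auto
    then show ?thesis using False by (auto simp: \<alpha>\<^sub>k_def)
  next
    case True
    then have i: "1 \<le> i" "i \<le> m" by auto
    \<comment> \<open>The transpositions interfere only at \<open>1\<close>, at the predecessor of
      \<open>k\<close>, and at \<open>m\<close>, where the cycle wraps round; elsewhere both sides
      are \<open>Suc i\<close>.\<close>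
    consider "i = 1" | "i = cyc_pred m k" "i \<noteq> 1" | "i = m" "i \<noteq> cyc_pred m k"
      | "i \<noteq> 1" "i \<noteq> cyc_pred m k" "i \<noteq> m" by blast
    then show ?thesis
    proof cases
      case 1
      then show ?thesis using k m by (auto simp: \<alpha>\<^sub>k_def cycle_of_list_upt)
    next
      case 2
      then have "\<alpha>\<^sub>k k i = tp 1 k 2" by (simp add: \<alpha>\<^sub>k_def \<alpha>_1)
      then show ?thesis using 2 k i m
        by (auto simp: cycle_of_list_upt cyc_pred_def split: if_splits)
    next
      case 3
      then have "\<alpha>\<^sub>k k i = k" using m \<alpha>_cycle[of m] by (simp add: \<alpha>\<^sub>k_def)
      then show ?thesis using 3 k i m
        by (auto simp: cycle_of_list_upt cyc_pred_def split: if_splits)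
    next
      case 4
      then have "\<alpha> i = Suc i" using \<alpha>_cycle i by simp
      moreover have "Suc i \<noteq> k" using 4 i by (auto simp: cyc_pred_def)
      ultimately have "\<alpha>\<^sub>k k i = Suc i" using 4 i by (simp add: \<alpha>\<^sub>k_def)
      then show ?thesis using 4 k i m
        by (auto simp: cycle_of_list_upt cyc_pred_def split: if_splits)
    qed
  qed
  then show ?thesis unfolding phi_def \<sigma>\<^sub>k_def prod.case by (simp only: refl prod.inject fun_eq_iff simp_thms)
qed

lemma \<alpha>\<^sub>k_eq: "\<alpha>\<^sub>k k = tp 1 k \<circ> (tp 2 k \<circ> \<alpha>)"
  unfolding \<alpha>\<^sub>k_def comp_transp_conj[OF inj_\<alpha>] \<alpha>_cyc_pred \<alpha>_1 by (rule refl)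

lemma \<alpha>\<^sub>k_permutes: "\<alpha>\<^sub>k k permutes {1..n}"
  unfolding \<alpha>\<^sub>k_def using \<alpha> in_points by (intro transp_comp_permutes comp_transp_permutes)

lemma \<sigma>\<^sub>k_permutes: "\<sigma>\<^sub>k k permutes {1..n}"
  unfolding \<sigma>\<^sub>k_def using \<sigma> transp_comp_permutes[OF \<sigma> in_points(1,3)] by simp

lemma \<alpha>\<^sub>k_1: "\<alpha>\<^sub>k k 1 = 1"
  by (simp add: \<alpha>\<^sub>k_def)

lemma permutation_\<sigma>: "permutation \<sigma>"
  using \<sigma> by (simp add: permutes_finite_permutation)

lemma conn_\<sigma>\<^sub>k: "(1, k) \<in> conn (gr (\<sigma>\<^sub>k k))"
proof (cases "same_cycle \<sigma> 1 k")
  case True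
  then show ?thesis by (simp add: \<sigma>\<^sub>k_def same_cycle_def mem_orbit_iff_conn[OF permutation_\<sigma>])
next
  case False
  then show ?thesis
    using conn_gr_transp_comp[OF permutation_\<sigma>, of k 1] conn_incl[of "(1, k)" "insert (1, k) (gr \<sigma>)"]
    by (simp add: \<sigma>\<^sub>k_def same_cycle_def)
qed

lemma num_cycles_\<sigma>:
  "num_cycles {1..n} \<sigma> = (if same_cycle \<sigma> 1 k then num_cycles {1..n} (\<sigma>\<^sub>k k)
     else Suc (num_cycles {1..n} (\<sigma>\<^sub>k k)))"
  using num_cycles_transp_comp_diff[OF _ \<sigma> in_points(1,3)] by (simp add: \<sigma>\<^sub>k_def same_cycle_def)

text \<open>Write \<open>l\<close> for the predecessor of \<open>k\<close>. The factor
  \<open>(1,k)\<close> adds a cycle to \<open>\<beta>\<close> unless \<open>k = 1\<close>, and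
  \<open>(1,l)\<close> adds one to the quotient unless \<open>l = 1\<close>. Passing from
  \<open>\<alpha>\<close> to \<open>\<alpha>\<^sub>k k\<close> adds the same two amounts, so the
  equation of \<open>refinement_iff\<close> is preserved.\<close>

lemma refinement_transp_iff:
  assumes \<beta>: "\<beta> permutes {1..n}" and k\<beta>: "\<beta> 1 = k"
  shows "refinement {1..n} (tp 1 k \<circ> \<beta>) (\<alpha>\<^sub>k k) \<longleftrightarrow> refinement {1..n} \<beta> \<alpha>"
proof -
  let ?z = "num_cycles {1..n}" and ?\<gamma> = "inv' \<beta> \<circ> \<alpha>" and ?l = "cyc_pred m k"
  have \<gamma>: "?\<gamma> permutes {1..n}" using \<alpha> \<beta> by (intro permutes_compose permutes_inv)
  have \<alpha>l: "\<alpha> \<circ> tp 1 ?l permutes {1..n}" using \<alpha> in_points by (intro comp_transp_permutes)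
  have orbI: "q 1 = k \<Longrightarrow> k \<in> Orbits.orbit q 1" for q using orbit.base[of q 1] by simp
  have z\<beta>: "?z (tp 1 k \<circ> \<beta>) = (if k = 1 then 0 else 1) + ?z \<beta>"
    using num_cycles_transp_comp_same[OF _ \<beta> in_points(1,3)] orbI[of \<beta>] k\<beta> by simp
  \<comment> \<open>\<open>\<alpha>\<close> sends the predecessor of \<open>k\<close> to
    \<open>k = \<beta> 1\<close>, and the inverse of \<open>\<beta>\<close> takes this back to
    \<open>1\<close>.\<close>
  have "?\<gamma> ?l = 1" using k\<beta> permutes_inverses(2)[OF \<beta>, of 1] by simp
  then have "1 \<in> Orbits.orbit ?\<gamma> ?l" using orbit.base[of ?\<gamma> ?l] by simp
  then have z\<gamma>: "?z (?\<gamma> \<circ> tp 1 ?l) = (if ?l = 1 then 0 else 1) + ?z ?\<gamma>"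
    using num_cycles_comp_transp_same[OF _ \<gamma> in_points(4,1)] by (simp add: transpose_commute)
  have "?l \<in> Orbits.orbit \<alpha> 1"
    using conn_\<alpha>[OF cyc_pred_mem] \<alpha> by (simp add: mem_orbit_iff_conn permutes_finite_permutation)
  then have "?z (\<alpha> \<circ> tp 1 ?l) = (if ?l = 1 then 0 else 1) + ?z \<alpha>"
    using num_cycles_comp_transp_same[OF _ \<alpha> in_points(1,4)] by simp
  moreover have "?z (\<alpha>\<^sub>k k) = (if k = 1 then 0 else 1) + ?z (\<alpha> \<circ> tp 1 ?l)"
    using num_cycles_transp_comp_same[OF _ \<alpha>l in_points(1,3)] orbI[of "\<alpha> \<circ> tp 1 ?l"]
    by (simp add: \<alpha>\<^sub>k_def)
  moreover have "inv' (tp 1 k \<circ> \<beta>) \<circ> \<alpha>\<^sub>k k = ?\<gamma> \<circ> tp 1 ?l"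
    using permutes_bij[OF \<beta>] by (simp add: o_inv_distrib \<alpha>\<^sub>k_def fun_eq_iff)
  ultimately show ?thesis
    using z\<beta> z\<gamma> \<beta> transp_comp_permutes[OF \<beta> in_points(1,3)]
    by (simp only: refinement_iff[OF finite_atLeastAtMost] \<alpha> \<alpha>\<^sub>k_permutes) auto
qed

text \<open>A refinement stays inside the cycles of \<open>\<alpha>\<^sub>k k\<close>, one of which
  is \<open>{1}\<close>. Hence multiplying by \<open>(1,k)\<close> leads back to a permutation with
  value \<open>k\<close> at \<open>1\<close>.\<close>

lemma refinement_\<alpha>\<^sub>k_fixes:
  assumes "refinement {1..n} \<beta> (\<alpha>\<^sub>k k)"
  shows "\<beta> 1 = 1"
proof -
  have "(1, \<beta> 1) \<in> conn (gr (\<alpha>\<^sub>k k))"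
    using refinement_imp_conn[OF _ \<alpha>\<^sub>k_permutes assms] by (auto simp: gr_subset_conn_iff)
  then have "\<beta> 1 \<in> Orbits.orbit (\<alpha>\<^sub>k k) 1"
    using \<alpha>\<^sub>k_permutes by (simp add: mem_orbit_iff_conn permutes_finite_permutation)
  moreover have "Orbits.orbit (\<alpha>\<^sub>k k) 1 = {1}" using \<alpha>\<^sub>k_1 by (simp add: orbit_eq_singleton_iff)
  ultimately show ?thesis by simp
qed

text \<open>The two pairs differ by transpositions along the edges in \<open>?E\<close>, so they
  have the same classes once \<open>?E\<close> is added. For \<open>(\<sigma>, \<alpha>)\<close>
  these edges lie within the marked cycle; for the other pair \<open>(1, k)\<close> is supplied by
  \<open>\<sigma>\<^sub>k k\<close>, and only \<open>(1, 2)\<close> has to be added.\<close>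

lemma conn_phi: "conn (insert (1, 2) (gr (\<sigma>\<^sub>k k) \<union> gr (\<alpha>\<^sub>k k))) = conn (gr \<sigma> \<union> gr \<alpha>)"
proof -
  let ?E = "{(1, 2), (1, k), (2, k)} :: (nat \<times> nat) set"
  have E: "e \<in> conn (?E \<union> R)" if "e \<in> ?E" for e R using that by (intro conn_incl) blast
  have "?E \<subseteq> conn (insert (1, 2) (gr (\<sigma>\<^sub>k k) \<union> gr (\<alpha>\<^sub>k k)))" (is "_ \<subseteq> ?C")
  proof -
    have 12: "(1, 2) \<in> ?C" by (intro conn_incl) simp
    have 1: "(1, k) \<in> ?C"
      using conn_\<sigma>\<^sub>k conn_mono[of "gr (\<sigma>\<^sub>k k)" "insert (1, 2) (gr (\<sigma>\<^sub>k k) \<union> gr (\<alpha>\<^sub>k k))"] by blast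
    show ?thesis using 12 1 conn_trans[OF conn_sym[OF 12] 1] by blast
  qed
  then have "conn (insert (1, 2) (gr (\<sigma>\<^sub>k k) \<union> gr (\<alpha>\<^sub>k k))) = conn (gr (\<alpha>\<^sub>k k) \<union> (?E \<union> gr (\<sigma>\<^sub>k k)))"
    by (intro conn_eqI) (auto simp: conn_incl)
  also have "\<dots> = conn (gr \<alpha> \<union> (?E \<union> gr (\<sigma>\<^sub>k k)))"
    unfolding \<alpha>\<^sub>k_eq using E by (simp only: conn_transp_absorb insertI1 insertI2)
  also have "\<dots> = conn (gr (\<sigma>\<^sub>k k) \<union> (?E \<union> gr \<alpha>))" by (simp only: Un_ac)
  also have "\<dots> = conn (gr \<sigma> \<union> (?E \<union> gr \<alpha>))"
    unfolding \<sigma>\<^sub>k_def using E by (simp add: conn_transp_absorb del: Un_insert_left Un_insert_right)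
  also have "\<dots> = conn (gr \<sigma> \<union> gr \<alpha>)"
  proof -
    have "?E \<subseteq> conn (gr \<alpha>)"
      using conn_\<alpha>[OF k] conn_\<alpha>[of 2] m conn_trans[OF conn_sym[of 1 2 "gr \<alpha>"], of k] by simp
    then have "?E \<subseteq> conn (gr \<sigma> \<union> gr \<alpha>)" using conn_mono[of "gr \<alpha>" "gr \<sigma> \<union> gr \<alpha>"] by blast
    then show ?thesis by (intro conn_eqI) (auto simp: conn_incl)
  qed
  finally show ?thesis .
qed

lemma num_components_phi_bounds:
  "num_components n (\<sigma>, \<alpha>) \<le> num_components n (\<sigma>\<^sub>k k, \<alpha>\<^sub>k k)"
  "num_components n (\<sigma>\<^sub>k k, \<alpha>\<^sub>k k) \<le> Suc (num_components n (\<sigma>, \<alpha>))"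
  using num_classes_le_insert[OF _ in_points(1,2), of "gr (\<sigma>\<^sub>k k) \<union> gr (\<alpha>\<^sub>k k)"]
    num_classes_conn_cong[OF conn_phi, of "{1..n}"]
  by (simp_all add: num_components_eq \<sigma> \<alpha> \<sigma>\<^sub>k_permutes \<alpha>\<^sub>k_permutes)

text \<open>Were \<open>1\<close> and \<open>2\<close> already connected, the edge
  \<open>(1, 2)\<close> of \<open>conn_phi\<close> would change nothing. This supplies the
  hypothesis of \<open>whitney_merge\<close>.\<close>

lemma conn_phi_12:
  assumes "num_components n (\<sigma>\<^sub>k k, \<alpha>\<^sub>k k) = Suc (num_components n (\<sigma>, \<alpha>))"
  shows "(1, 2) \<notin> conn (gr (\<sigma>\<^sub>k k) \<union> gr (\<alpha>\<^sub>k k))"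
proof
  assume "(1, 2) \<in> conn (gr (\<sigma>\<^sub>k k) \<union> gr (\<alpha>\<^sub>k k))"
  from conn_insert_absorb[OF this] conn_phi
  have "conn (gr (\<sigma>\<^sub>k k) \<union> gr (\<alpha>\<^sub>k k)) = conn (gr \<sigma> \<union> gr \<alpha>)" by simp
  from num_classes_conn_cong[OF this, of "{1..n}"] assms show False
    by (simp add: num_components_eq \<sigma> \<alpha> \<sigma>\<^sub>k_permutes \<alpha>\<^sub>k_permutes)
qed

text \<open>Both sides count the classes of \<open>\<sigma>\<close> and \<open>\<beta>\<close> with
  the edge \<open>(1, k)\<close> added: on the left it comes from \<open>1 \<mapsto> k\<close>, on
  the right from a cycle of \<open>\<sigma>\<^sub>k k\<close>.\<close>

lemma num_components_transp:
  assumes \<beta>: "\<beta> permutes {1..n}" and "\<beta> 1 = 1"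
  shows "num_components n (\<sigma>, tp 1 k \<circ> \<beta>) = num_components n (\<sigma>\<^sub>k k, \<beta>)"
proof -
  let ?Q = "gr \<beta> \<union> gr \<sigma>"
  have k1: "(tp 1 k \<circ> \<beta>) 1 = k" using assms(2) by simp
  have "(1, k) \<in> gr (tp 1 k \<circ> \<beta>) \<union> gr \<sigma>" using k1 unfolding gr_def by (metis UnI1 rangeI)
  then have "conn (gr \<sigma> \<union> gr (tp 1 k \<circ> \<beta>)) = conn (insert (1, k) (gr (tp 1 k \<circ> \<beta>) \<union> gr \<sigma>))"
    by (simp only: insert_absorb Un_commute)
  also have "\<dots> = conn (insert (1, k) ?Q)" by (rule conn_insert_transp)
  also have "\<dots> = conn (gr (\<sigma>\<^sub>k k) \<union> gr \<beta>)"
  proof (cases "same_cycle \<sigma> 1 k")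
    case True
    then have "\<sigma>\<^sub>k k = \<sigma>" by (simp add: \<sigma>\<^sub>k_def)
    moreover from this have "(1, k) \<in> conn ?Q"
      using conn_\<sigma>\<^sub>k conn_mono[of "gr \<sigma>" ?Q] by auto
    ultimately show ?thesis by (simp only: conn_insert_absorb Un_commute)
  next
    case False
    then have "conn (gr (\<sigma>\<^sub>k k)) = conn (insert (1, k) (gr \<sigma>))"
      using conn_gr_transp_comp[OF permutation_\<sigma>, of k 1] by (simp add: \<sigma>\<^sub>k_def same_cycle_def)
    from conn_Un_cong[OF this refl, of "gr \<beta>"] show ?thesis by (simp add: Un_commute)
  qed
  finally show ?thesis
    using num_classes_conn_cong transp_comp_permutes[OF \<beta> in_points(1,3)]
    by (simp only: num_components_eq \<sigma> \<beta> \<sigma>\<^sub>k_permutes)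
qed

text \<open>The exponent of \<open>u\<close> telescopes through the component number of
  \<open>phi\<close>. In the exponent of \<open>v\<close>, for \<open>k \<noteq> 1\<close>, the
  permutation \<open>\<beta>'\<close> has one cycle fewer than \<open>\<beta>\<close>; this is
  offset by the cycle that \<open>\<sigma>\<^sub>k k\<close> loses when \<open>1\<close> and
  \<open>k\<close> are joined, and otherwise one factor \<open>v\<close> remains.\<close>

lemma whitney_term:
  assumes r: "refinement {1..n} \<beta> (\<alpha>\<^sub>k k)"
  defines "\<beta>' \<equiv> tp 1 k \<circ> \<beta>"
  shows "u ^ (num_components n (\<sigma>, \<beta>') - num_components n (\<sigma>, \<alpha>)) *
      v ^ (num_components n (\<sigma>, \<beta>') + n - num_cycles {1..n} \<beta>' - num_cycles {1..n} \<sigma>) =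
    u ^ (num_components n (\<sigma>\<^sub>k k, \<beta>) - num_components n (\<sigma>\<^sub>k k, \<alpha>\<^sub>k k)) *
      v ^ (num_components n (\<sigma>\<^sub>k k, \<beta>) + n - num_cycles {1..n} \<beta> - num_cycles {1..n} (\<sigma>\<^sub>k k)) *
      weight n m k (\<sigma>, \<alpha>) u (v :: 'r :: comm_ring_1)"
proof -
  let ?\<kappa> = "num_components n" and ?z = "num_cycles {1..n}"
  have \<beta>: "\<beta> permutes {1..n}" using r by (simp add: refinement_def)
  have \<beta>1: "\<beta> 1 = 1" using refinement_\<alpha>\<^sub>k_fixes[OF r] .
  have \<beta>'1: "\<beta>' 1 = k" using \<beta>1 by (simp add: \<beta>'_def)
  have \<beta>': "\<beta>' permutes {1..n}" unfolding \<beta>'_def by (rule transp_comp_permutes[OF \<beta> in_points(1,3)])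
  have \<kappa>: "?\<kappa> (\<sigma>, \<beta>') = ?\<kappa> (\<sigma>\<^sub>k k, \<beta>)"
    unfolding \<beta>'_def using \<beta> \<beta>1 by (rule num_components_transp)
  have "tp 1 k \<circ> \<beta>' = \<beta>" by (simp add: \<beta>'_def fun_eq_iff)
  moreover have "k \<in> Orbits.orbit \<beta>' 1" using \<beta>'1 orbit.base[of \<beta>' 1] by simp
  ultimately have z: "?z \<beta> = (if k = 1 then 0 else 1) + ?z \<beta>'"
    using num_cycles_transp_comp_same[OF _ \<beta>' in_points(1,3)] by (auto simp: \<beta>'_def)
  have "gr (\<sigma>\<^sub>k k) \<union> gr \<beta> \<subseteq> conn (gr (\<sigma>\<^sub>k k) \<union> gr (\<alpha>\<^sub>k k))"
    using refinement_imp_conn[OF _ \<alpha>\<^sub>k_permutes r]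
      conn_mono[of "gr (\<alpha>\<^sub>k k)" "gr (\<sigma>\<^sub>k k) \<union> gr (\<alpha>\<^sub>k k)"] by (auto intro: conn_incl)
  from num_classes_antimono[OF _ conn_subsetI[OF this], of "{1..n}"]
  have "?\<kappa> (\<sigma>\<^sub>k k, \<alpha>\<^sub>k k) \<le> ?\<kappa> (\<sigma>\<^sub>k k, \<beta>)"
    by (simp add: num_components_eq \<beta> \<sigma>\<^sub>k_permutes \<alpha>\<^sub>k_permutes)
  then have u: "?\<kappa> (\<sigma>\<^sub>k k, \<beta>) - ?\<kappa> (\<sigma>, \<alpha>) =
      (?\<kappa> (\<sigma>\<^sub>k k, \<beta>) - ?\<kappa> (\<sigma>\<^sub>k k, \<alpha>\<^sub>k k)) + (?\<kappa> (\<sigma>\<^sub>k k, \<alpha>\<^sub>k k) - ?\<kappa> (\<sigma>, \<alpha>))"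
    using num_components_phi_bounds(1) by simp
  \<comment> \<open>Makes the natural subtractions in the exponent of \<open>v\<close>
    exact.\<close>
  have le: "?z (\<sigma>\<^sub>k k) + ?z \<beta> \<le> ?\<kappa> (\<sigma>\<^sub>k k, \<beta>) + n"
    using num_cycles_sum_le[OF _ \<sigma>\<^sub>k_permutes \<beta>] by (simp add: num_components_eq \<beta> \<sigma>\<^sub>k_permutes)
  have refl1: "same_cycle \<sigma> 1 1"
    by (simp add: same_cycle_def permutation_self_in_orbit[OF permutation_\<sigma>])
  have v: "?\<kappa> (\<sigma>\<^sub>k k, \<beta>) + n - ?z \<beta>' - ?z \<sigma> =
      (?\<kappa> (\<sigma>\<^sub>k k, \<beta>) + n - ?z \<beta> - ?z (\<sigma>\<^sub>k k)) + (if k \<noteq> 1 \<and> same_cycle \<sigma> 1 k then 1 else 0)"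
    using z le num_cycles_\<sigma> refl1 by (auto split: if_splits)
  show ?thesis
    unfolding \<kappa> u v weight_def phi_eq by (simp add: power_add mult_ac)
qed

text \<open>The number of cycles rises under \<open>(1,k)\<close> exactly when
  \<open>k \<noteq> 1\<close> and \<open>1\<close>, \<open>k\<close> share a cycle of
  \<open>\<sigma>\<close>. If the component numbers agree, \<open>psi\<close> and \<open>phi\<close>
  coincide; otherwise they differ by a factor \<open>(1,2)\<close> on the first permutation, which
  \<open>whitney_merge\<close> absorbs.\<close>

lemma whitney_psi: "whitney n (psi n m k (\<sigma>, \<alpha>)) u v = whitney n (\<sigma>\<^sub>k k, \<alpha>\<^sub>k k) u v"
proof -
  let ?z = "num_cycles {1..n}" and ?\<kappa> = "num_components n" and ?l = "cyc_pred m k"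
  have \<kappa>: "?\<kappa> (\<sigma>\<^sub>k k, \<alpha>\<^sub>k k) = ?\<kappa> (\<sigma>, \<alpha>) \<or> ?\<kappa> (\<sigma>\<^sub>k k, \<alpha>\<^sub>k k) = ?\<kappa> (\<sigma>, \<alpha>) + 1"
    using num_components_phi_bounds by linarith
  have merge: "whitney n (tp 1 2 \<circ> \<sigma>\<^sub>k k, \<alpha>\<^sub>k k) u v = whitney n (\<sigma>\<^sub>k k, \<alpha>\<^sub>k k) u v" "k \<noteq> 2"
    if "?\<kappa> (\<sigma>\<^sub>k k, \<alpha>\<^sub>k k) = ?\<kappa> (\<sigma>, \<alpha>) + 1"
  proof -
    have nc: "(1, 2) \<notin> conn (gr (\<sigma>\<^sub>k k) \<union> gr (\<alpha>\<^sub>k k))" using conn_phi_12 that by simp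
    then show "whitney n (tp 1 2 \<circ> \<sigma>\<^sub>k k, \<alpha>\<^sub>k k) u v = whitney n (\<sigma>\<^sub>k k, \<alpha>\<^sub>k k) u v"
      by (intro whitney_merge \<sigma>\<^sub>k_permutes \<alpha>\<^sub>k_permutes in_points)
    show "k \<noteq> 2"
      using nc conn_\<sigma>\<^sub>k conn_mono[of "gr (\<sigma>\<^sub>k k)" "gr (\<sigma>\<^sub>k k) \<union> gr (\<alpha>\<^sub>k k)"] by auto
  qed
  \<comment> \<open>Rests on \<open>(1,k)(2,k) = (1,2)(1,k)\<close>, which fails for
    \<open>k = 2\<close>.\<close>
  have \<alpha>2: "\<alpha>\<^sub>k k = tp 1 2 \<circ> (tp 1 k \<circ> \<alpha>)" if "k \<noteq> 2"
    using that unfolding \<alpha>\<^sub>k_eq fun_eq_iff by (auto simp: Transposition.transpose_def)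
  have \<alpha>m: "\<alpha> m = 1" using \<alpha>_cycle[of m] m by simp
  show ?thesis
  proof (cases "k \<noteq> 1 \<and> same_cycle \<sigma> 1 k")
    case True
    then have s: "\<sigma>\<^sub>k k = \<sigma>" and z: "?z (tp 1 k \<circ> \<sigma>) = ?z \<sigma> + 1"
      using num_cycles_transp_comp_same[OF _ \<sigma> in_points(1,3)] by (auto simp: \<sigma>\<^sub>k_def same_cycle_def)
    from \<kappa> show ?thesis
    proof
      assume K: "?\<kappa> (\<sigma>\<^sub>k k, \<alpha>\<^sub>k k) = ?\<kappa> (\<sigma>, \<alpha>)"
      \<comment> \<open>As \<open>k \<noteq> 1\<close>, the predecessor of \<open>k\<close> is below
        \<open>m\<close>. Hence \<open>\<alpha> \<circ> tp 1 ?l\<close> sends \<open>1\<close> and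
        \<open>m\<close> to \<open>k\<close> and \<open>1\<close>, and the right factor
        \<open>(1,m)\<close> turns into the left factor \<open>(1,k)\<close>.\<close>
      have "tp 1 ?l m = m" using True k m by (auto simp: cyc_pred_def)
      then have "(\<alpha> \<circ> tp 1 ?l) \<circ> tp 1 m = \<alpha>\<^sub>k k"
        using comp_transp_conj[OF inj_compose[OF inj_\<alpha>, of "tp 1 ?l"], of 1 m] \<alpha>m
        by (simp add: \<alpha>\<^sub>k_def transpose_commute)
      then show ?thesis using K s z by (simp add: psi_def Let_def phi_eq)
    next
      assume K: "?\<kappa> (\<sigma>\<^sub>k k, \<alpha>\<^sub>k k) = ?\<kappa> (\<sigma>, \<alpha>) + 1"
      have "\<alpha>\<^sub>k k = tp 1 2 \<circ> \<alpha> \<circ> tp ?l m"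
        using \<alpha>2[OF merge(2)[OF K]] comp_transp_conj[OF inj_\<alpha>, of ?l m] \<alpha>m
        by (simp add: o_assoc[symmetric] transpose_commute)
      then show ?thesis using K s z merge(1)[OF K] by (simp add: psi_def Let_def phi_eq)
    qed
  next
    case False
    then have s: "\<sigma>\<^sub>k k = tp 1 k \<circ> \<sigma>" by (auto simp: \<sigma>\<^sub>k_def)
    then have z: "?z (tp 1 k \<circ> \<sigma>) \<le> ?z \<sigma>" using num_cycles_\<sigma> by (auto split: if_splits)
    from \<kappa> show ?thesis
    proof
      assume K: "?\<kappa> (\<sigma>\<^sub>k k, \<alpha>\<^sub>k k) = ?\<kappa> (\<sigma>, \<alpha>)"
      then show ?thesis using s z by (simp add: psi_def Let_def phi_eq \<alpha>\<^sub>k_def o_assoc)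
    next
      assume K: "?\<kappa> (\<sigma>\<^sub>k k, \<alpha>\<^sub>k k) = ?\<kappa> (\<sigma>, \<alpha>) + 1"
      then show ?thesis using s z \<alpha>2[OF merge(2)[OF K]] merge(1)[OF K]
        by (simp add: psi_def Let_def phi_eq o_assoc)
    qed
  qed
qed

end

section \<open>Summation over the fibres of \<open>\<beta> \<mapsto> \<beta> 1\<close>\<close>

lemma whitney_recursion:
  "whitney n (\<sigma>, \<alpha>) u (v :: 'r :: comm_ring_1) =
    (\<Sum>k = 1..m. whitney n (\<sigma>\<^sub>k k, \<alpha>\<^sub>k k) u v * weight n m k (\<sigma>, \<alpha>) u v)"
proof -
  let ?S = "{1..n}" and ?\<kappa> = "num_components n" and ?z = "num_cycles {1..n}"
  let ?f = "\<lambda>\<beta>. u ^ (?\<kappa> (\<sigma>, \<beta>) - ?\<kappa> (\<sigma>, \<alpha>)) * v ^ (?\<kappa> (\<sigma>, \<beta>) + n - ?z \<beta> - ?z \<sigma>)"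
  let ?R = "{\<beta>. refinement ?S \<beta> \<alpha>}"
  have "?R \<subseteq> {p. p permutes ?S}" by (auto simp: refinement_def)
  then have fin: "finite ?R" using finite_permutations[of ?S] finite_subset by blast
  have "\<beta> 1 \<in> {1..m}" if "refinement ?S \<beta> \<alpha>" for \<beta>
  proof -
    have "(1, \<beta> 1) \<in> conn (gr \<alpha>)"
      using refinement_imp_conn[OF _ \<alpha> that] by (auto simp: gr_subset_conn_iff)
    then show ?thesis
      using orbit_\<alpha> \<alpha> mem_orbit_iff_conn[of \<alpha>] by (auto simp: permutes_finite_permutation)
  qed
  then have "(\<lambda>\<beta>. \<beta> 1) ` ?R \<subseteq> {1..m}" by blast
  from sum.group[OF fin finite_atLeastAtMost this, of ?f]
  have "whitney n (\<sigma>, \<alpha>) u v = (\<Sum>k = 1..m. \<Sum>\<beta> | \<beta> \<in> ?R \<and> \<beta> 1 = k. ?f \<beta>)"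
    by (simp add: whitney_def)
  also have "\<dots> = (\<Sum>k = 1..m. whitney n (\<sigma>\<^sub>k k, \<alpha>\<^sub>k k) u v * weight n m k (\<sigma>, \<alpha>) u v)"
  proof (intro sum.cong refl)
    fix k assume k: "k \<in> {1..m}"
    have inv: "tp 1 k \<circ> (tp 1 k \<circ> \<beta>) = \<beta>" for \<beta> :: "nat \<Rightarrow> nat" by (simp add: fun_eq_iff)
    have "(\<Sum>\<beta> | \<beta> \<in> ?R \<and> \<beta> 1 = k. ?f \<beta>) =
      (\<Sum>\<beta> | refinement ?S \<beta> (\<alpha>\<^sub>k k).
        u ^ (?\<kappa> (\<sigma>\<^sub>k k, \<beta>) - ?\<kappa> (\<sigma>\<^sub>k k, \<alpha>\<^sub>k k)) * v ^ (?\<kappa> (\<sigma>\<^sub>k k, \<beta>) + n - ?z \<beta> - ?z (\<sigma>\<^sub>k k)) *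
        weight n m k (\<sigma>, \<alpha>) u v)"
    \<comment> \<open>Multiplication by \<open>(1,k)\<close> is an involution, so the same map
      serves in both directions.\<close>
    proof (rule sum.reindex_bij_witness[of _ "\<lambda>\<beta>. tp 1 k \<circ> \<beta>" "\<lambda>\<beta>. tp 1 k \<circ> \<beta>"])
      fix \<beta> assume "\<beta> \<in> {\<beta>. \<beta> \<in> ?R \<and> \<beta> 1 = k}"
      then have r: "refinement ?S \<beta> \<alpha>" "\<beta> 1 = k" by auto
      then have "\<beta> permutes ?S" by (simp add: refinement_def)
      then have r': "refinement ?S (tp 1 k \<circ> \<beta>) (\<alpha>\<^sub>k k)"
        using refinement_transp_iff[OF k, of \<beta>] r by simp
      then show "tp 1 k \<circ> \<beta> \<in> {\<beta>. refinement ?S \<beta> (\<alpha>\<^sub>k k)}" by blast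
      show "tp 1 k \<circ> (tp 1 k \<circ> \<beta>) = \<beta>" by (rule inv)
      show "u ^ (?\<kappa> (\<sigma>\<^sub>k k, tp 1 k \<circ> \<beta>) - ?\<kappa> (\<sigma>\<^sub>k k, \<alpha>\<^sub>k k)) *
          v ^ (?\<kappa> (\<sigma>\<^sub>k k, tp 1 k \<circ> \<beta>) + n - ?z (tp 1 k \<circ> \<beta>) - ?z (\<sigma>\<^sub>k k)) *
          weight n m k (\<sigma>, \<alpha>) u v = ?f \<beta>"
        using whitney_term[OF k r', of u v] unfolding inv by (rule sym)
    next
      fix \<beta> assume "\<beta> \<in> {\<beta>. refinement ?S \<beta> (\<alpha>\<^sub>k k)}"
      then have r: "refinement ?S \<beta> (\<alpha>\<^sub>k k)" by blast
      have p: "\<beta> permutes ?S" using r by (simp add: refinement_def)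
      have "(tp 1 k \<circ> \<beta>) 1 = k" using refinement_\<alpha>\<^sub>k_fixes[OF k r] by simp
      moreover have "tp 1 k \<circ> \<beta> permutes ?S"
        by (rule transp_comp_permutes[OF p in_points(1,3)[OF k]])
      ultimately have "refinement ?S (tp 1 k \<circ> \<beta>) \<alpha>" "(tp 1 k \<circ> \<beta>) 1 = k"
        using refinement_transp_iff[OF k, of "tp 1 k \<circ> \<beta>"] r unfolding inv by blast+
      then show "tp 1 k \<circ> \<beta> \<in> {\<beta>. \<beta> \<in> ?R \<and> \<beta> 1 = k}" by blast
      show "tp 1 k \<circ> (tp 1 k \<circ> \<beta>) = \<beta>" by (rule inv)
    qed
    also have "\<dots> = whitney n (\<sigma>\<^sub>k k, \<alpha>\<^sub>k k) u v * weight n m k (\<sigma>, \<alpha>) u v"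
      by (simp only: whitney_def prod.case sum_distrib_right)
    finally show "(\<Sum>\<beta> | \<beta> \<in> ?R \<and> \<beta> 1 = k. ?f \<beta>) = \<dots>" .
  qed
  finally show ?thesis .
qed

end

theorem theorem2p11:
  fixes n m :: nat and \<sigma> \<alpha> :: "nat \<Rightarrow> nat" and u v :: "'r::comm_ring_1"
  assumes "hypermaps_on n (\<sigma>, \<alpha>)"
    and "m \<ge> 2"
    and "list_is_cycle \<alpha> [1..<m + 1]"
  shows "whitney n (\<sigma>, \<alpha>) u v =
    (\<Sum>k = 1..m. whitney n (psi n m k (\<sigma>, \<alpha>)) u v * weight n m k (\<sigma>, \<alpha>) u v)"
proof -
  interpret pointed_hypermaps n m \<sigma> \<alpha>
    by unfold_locales (use assms in \<open>simp_all add: hypermaps_on_def\<close>)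
  show ?thesis
    unfolding whitney_recursion by (intro sum.cong refl) (simp only: whitney_psi)
qed

end
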